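(* Let $0<\beta\le\alpha<1$ and let $\phi:[2,\infty)\to(0,\infty)$ be a nondecreasing function such that $\lim_{t\to\infty}\phi(t)=\infty$ and, for some constant $C_0$, $\phi(2t)\le\phi(t)+C_0$ for all $t\ge 2$. Then there exist a compact set $E\subset\mathbb R$, a Borel probability measure $\mu$ on $\mathbb R$ supported on $E$, a sequence $\{f_l\}_{l\ge1}$ of functions, each of which is the indicator function of a finite union of intervals and satisfies $\|f_l\|_{L^2(\mu)}>0$, and constants $0<c\le C<\infty$, such that the following three properties hold. (i) $|\hat\mu(\xi)|\le C|\xi|^{-\beta/2}$ for all $\xi\in\mathbb R$, $\xi\neq0$. (ii) For all intervals $I\subset\mathbb R$ centered in $E$ with $0<|I|<1/2$, $$c\,\frac{|I|^\alpha}{\phi(1/|I|)\log(1/|I|)}\le\mu(I)\le C\,\frac{|I|^\alpha}{\log(1/|I|)}.$$ (iii) For every $q$ with $2\le q<2+\frac{4(1-\alpha)}{\beta}$, $$\sup_{l\ge1}\frac{\|\widehat{f_l\mu}\|_{L^q(\mathbb R)}}{\|f_l\|_{L^2(\mu)}}=\infty.$$ Moreover, if $\beta<\alpha$, then there exist such $E$, $\mu$, $\{f_l\}_{l\ge1}$ and $c,C$ (possibly different from those above) satisfying (i), (iii) and, in place of (ii), the following: (ii') For all intervals $I\subset\mathbb R$ centered in $E$ with $0<|I|<1/2$, $$c\,\frac{|I|^\alpha}{\phi(1/|I|)}\le\mu(I)\le C\,|I|^\alpha.$$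
   Context: For a finite Borel measure $\nu$ on $\mathbb R$, $\hat\nu(\xi)=\int_{\mathbb R}e^{-2\pi i\xi x}\,d\nu(x)$; $f_l\mu$ denotes the measure with density $f_l$ with respect to $\mu$, so $\widehat{f_l\mu}(\xi)=\int e^{-2\pi i\xi x}f_l(x)\,d\mu(x)$. $L^q(\mathbb R)$ is taken with respect to Lebesgue measure (the norm may be $+\infty$). A Borel probability measure $\mu$ is said to be supported on a set $E$ if $\mu(E)=1$. For an interval $I$, $|I|$ denotes its length; $I$ is centered in $E$ if its midpoint belongs to $E$. $\log$ is the natural logarithm. The constants $c,C$ do not depend on $\xi$ or $I$; the measure $\mu$ and the sequence $\{f_l\}$ do not depend on $q$. *)

theory Defs
  imports "HOL-Probability.Probability"
begin

definition fourier_measure :: "real measure \<Rightarrow> real \<Rightarrow> complex" where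
  "fourier_measure \<nu> \<xi> =
     (LINT x|\<nu>. exp (- (2 * complex_of_real pi * \<i> * complex_of_real \<xi> * complex_of_real x)))"

text \<open>
  Takes values in the extended nonnegative reals, so that a measurable function outside \<open>L\<^sup>q\<close>
  has norm \<open>\<infinity>\<close>. The case distinction is needed because \<open>powr\<close> is not available on \<open>ennreal\<close>.
\<close>
definition Lq_norm ::
    "real \<Rightarrow> 'a measure \<Rightarrow> ('a \<Rightarrow> 'b::real_normed_vector) \<Rightarrow> ennreal" where
  "Lq_norm q M g =
     (let J = (\<integral>\<^sup>+ x. ennreal (norm (g x) powr q) \<partial>M)
      in if J = \<infinity> then \<infinity> else ennreal (enn2real J powr (1 / q)))"

definition finite_union_of_intervals :: "real set \<Rightarrow> bool" where
  "finite_union_of_intervals S \<longleftrightarrow>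
     (\<exists>\<J>. finite \<J> \<and> (\<forall>J\<in>\<J>. is_interval J) \<and> S = \<Union>\<J>)"

text \<open>
  Intervals may be open, closed or half-open. \<open>Inf\<close> and \<open>Sup\<close> are the endpoints only for
  nonempty bounded sets, so the next two notions are meaningful only for such intervals.
\<close>
definition interval_length :: "real set \<Rightarrow> real" where
  "interval_length I = Sup I - Inf I"

definition interval_centered_in :: "real set \<Rightarrow> real set \<Rightarrow> bool" where
  "interval_centered_in I E \<longleftrightarrow>
     is_interval I \<and> bounded I \<and> I \<noteq> {} \<and> midpoint (Inf I) (Sup I) \<in> E"

end

theory Submission
  imports Defs
begin

text \<open>
  Points of the support are built from binary digits: at positions in a set \<open>S\<close> both digits are
  allowed, at the others the digit is a function of the preceding ones, chosen by signs that make
  all the exponential sums of that level as small as a random choice would. Spreading mass uniformly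
  gives \<open>\<mu>\<close>; its regularity is read off from the number of positions of \<open>S\<close> below \<open>n\<close>, which is about
  \<open>\<alpha> n\<close> or \<open>\<alpha> n + log n\<close>, and its Fourier transform is a sum over levels of signed sums of
  transforms of Haar functions.

  On the words whose digits vanish outside a subset \<open>A\<close> of \<open>S\<close> of density \<open>\<alpha> - \<beta>/2\<close> the chosen
  digit is forced to be \<open>0\<close>. This planted part has mass about \<open>2 ^ (- \<beta> n / 2)\<close> at level \<open>n\<close>, so it
  does not spoil the decay. It is a generalised arithmetic progression: its Fourier transform is a
  product over \<open>A\<close>, and it stays comparable to its maximum, up to a bounded factor for each run of \<open>A\<close>,
  on a set of frequencies of measure about \<open>2 ^ (n - |A \<inter> [0, n)|)\<close>. The runs grow in length, which
  makes these factors \<open>2 ^ o(n)\<close> and the ratio of norms unbounded below the stated exponent; the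
  deviation of \<open>S\<close> from its density caused by long runs is what \<open>\<phi>\<close> pays for.
\<close>

section \<open>Balanced choice of signs\<close>

text \<open>The exponents fit as follows. At level n put s = \<open>cnt S n\<close> and a =
  \<open>cnt A n\<close>. The planted part has mass 2 ^ (a - s), so its indicator has L2 norm 2 ^
  ((a - s) / 2), and its transform has about the size of that mass on a set of measure about 2 ^ (n
  - a). The ratio of norms is then about 2 ^ ((a - s) / 2 + (n - a) / q). With s = \<alpha> n and s
  - a = \<beta> n / 2, the largest planted part that the decay estimate tolerates, the exponent is n
  ((1 - \<alpha> + \<beta> / 2) / q - \<beta> / 4), which is positive exactly for q < 2 + 4 (1 -
  \<alpha>) / \<beta>. The logarithm in (ii) comes from the choice of signs: one choice has to serve
  exponentially many frequencies, which costs a factor sqrt (n + 1) on top of square root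
  cancellation. Decay of order \<beta> / 2 thus asks for about (n + 1) 2 ^ (\<beta> n) nodes at
  level n. For \<beta> < \<alpha> the density \<alpha> alone provides them; for \<beta> = \<alpha>
  the extra log n positions in S do.\<close>

lemma cosh_le_exp_half_square:
  fixes x :: real
  assumes "x \<ge> 0"
  shows "cosh x \<le> exp (x\<^sup>2 / 2)"
proof -
  \<comment> \<open>Hoeffding's lemma for a variable with two equally likely values.\<close>
  have "- (2 * x) * (1 / 2) + ln (1 + (1 / 2) * (exp (2 * x) - 1)) \<le> (2 * x)\<^sup>2 / 8"
    by (rule Hoeffdings_lemma_aux) (use assms in auto)
  moreover have "1 + (1 / 2) * (exp (2 * x) - 1) = cosh x * exp x"
    by (simp add: cosh_field_def field_simps flip: exp_add)
  moreover have "ln (cosh x * exp x) = ln (cosh x) + x"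
    by (simp add: ln_mult cosh_real_pos)
  ultimately have "ln (cosh x) \<le> x\<^sup>2 / 2"
    by (simp add: power2_eq_square)
  then show ?thesis
    by (simp add: ln_le_cancel_iff cosh_real_pos flip: ln_le_cancel_iff[of "cosh x" "exp (x\<^sup>2/2)"])
qed

text \<open>Method of conditional expectations: averaging over both values of the next sign
  multiplies each summand by \<open>cosh (lam * c t m)\<close>, at most
  \<open>exp (lam\<^sup>2 / 2)\<close>, so one of the two values does no worse than this
  average.\<close>

lemma sign_choice_cosh:
  fixes c :: "'t \<Rightarrow> nat \<Rightarrow> real" and lam :: real
  assumes T: "finite T" and c: "\<And>t j. t \<in> T \<Longrightarrow> j < m \<Longrightarrow> \<bar>c t j\<bar> \<le> 1"
  shows "\<exists>\<epsilon>::nat \<Rightarrow> real. (\<forall>j. \<epsilon> j \<in> {1, -1}) \<and>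
    (\<Sum>t\<in>T. cosh (lam * (\<Sum>j<m. \<epsilon> j * c t j))) \<le> real (card T) * exp (lam\<^sup>2 / 2) ^ m"
  using c
proof (induction m)
  case 0
  show ?case by (intro exI[of _ "\<lambda>_. 1"]) auto
next
  case (Suc m)
  then obtain \<epsilon> :: "nat \<Rightarrow> real" where \<epsilon>: "\<And>j. \<epsilon> j \<in> {1, -1}"
    and IH: "(\<Sum>t\<in>T. cosh (lam * (\<Sum>j<m. \<epsilon> j * c t j))) \<le> real (card T) * exp (lam\<^sup>2 / 2) ^ m"
    by force
  define X where "X t = lam * (\<Sum>j<m. \<epsilon> j * c t j)" for t
  define y where "y t = lam * c t m" for t
  have step: "(cosh (X t + y t) + cosh (X t - y t)) / 2 \<le> exp (lam\<^sup>2 / 2) * cosh (X t)"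
    if "t \<in> T" for t
  proof -
    have "cosh (y t) = cosh \<bar>y t\<bar>" by (simp add: abs_if)
    also have "\<dots> \<le> exp (\<bar>y t\<bar>\<^sup>2 / 2)" by (intro cosh_le_exp_half_square) simp
    also have "\<dots> \<le> exp (lam\<^sup>2 / 2)"
    proof -
      have "\<bar>c t m\<bar>\<^sup>2 \<le> 1\<^sup>2" using Suc.prems[OF that, of m] by (intro power_mono) auto
      then show ?thesis
        by (simp add: y_def power_mult_distrib mult_left_le)
    qed
    finally have "cosh (y t) \<le> exp (lam\<^sup>2 / 2)" .
    then have "cosh (y t) * cosh (X t) \<le> exp (lam\<^sup>2 / 2) * cosh (X t)"
      by (intro mult_right_mono) (auto simp: cosh_real_nonneg)
    then show ?thesis by (simp add: cosh_add cosh_diff)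
  qed
  have "(\<Sum>t\<in>T. cosh (X t + y t)) + (\<Sum>t\<in>T. cosh (X t - y t))
      = 2 * (\<Sum>t\<in>T. (cosh (X t + y t) + cosh (X t - y t)) / 2)"
    by (simp add: sum.distrib flip: sum_divide_distrib)
  also have "\<dots> \<le> 2 * (\<Sum>t\<in>T. exp (lam\<^sup>2 / 2) * cosh (X t))"
    using step by (intro mult_left_mono sum_mono) auto
  also have "\<dots> = 2 * (exp (lam\<^sup>2 / 2) * (\<Sum>t\<in>T. cosh (X t)))"
    by (simp add: sum_distrib_left)
  also have "\<dots> \<le> 2 * (exp (lam\<^sup>2 / 2) * (real (card T) * exp (lam\<^sup>2 / 2) ^ m))"
    using IH by (intro mult_left_mono) (auto simp: X_def)
  finally have "(\<Sum>t\<in>T. cosh (X t + y t)) + (\<Sum>t\<in>T. cosh (X t - y t))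
      \<le> 2 * (real (card T) * exp (lam\<^sup>2 / 2) ^ Suc m)" by (simp add: mult_ac)
  then consider "(\<Sum>t\<in>T. cosh (X t + y t)) \<le> real (card T) * exp (lam\<^sup>2 / 2) ^ Suc m"
    | "(\<Sum>t\<in>T. cosh (X t - y t)) \<le> real (card T) * exp (lam\<^sup>2 / 2) ^ Suc m" by linarith
  then obtain s :: real where s: "s \<in> {1, -1}"
    and le: "(\<Sum>t\<in>T. cosh (X t + s * y t)) \<le> real (card T) * exp (lam\<^sup>2 / 2) ^ Suc m"
    by cases (use that[of 1] that[of "-1"] in auto)
  have "lam * (\<Sum>j<Suc m. (\<epsilon>(m := s)) j * c t j) = X t + s * y t" for t
    by (simp add: X_def y_def algebra_simps)
  then show ?case
    using le s \<epsilon> by (intro exI[of _ "\<epsilon>(m := s)"]) auto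
qed

lemma sign_choice:
  fixes c :: "'t \<Rightarrow> nat \<Rightarrow> real" and b :: real
  assumes T: "finite T" and c: "\<And>t j. t \<in> T \<Longrightarrow> j < m \<Longrightarrow> \<bar>c t j\<bar> \<le> 1"
    and m: "m > 0" and b: "b > 0" "2 * real (card T) \<le> exp (3 / 2 * b)"
  shows "\<exists>\<epsilon>::nat \<Rightarrow> real. (\<forall>j. \<epsilon> j \<in> {1, -1}) \<and>
    (\<forall>t\<in>T. \<bar>\<Sum>j<m. \<epsilon> j * c t j\<bar> \<le> 2 * sqrt (b * real m))"
proof -
  \<comment> \<open>With this value \<open>lam\<^sup>2 * m = b\<close>. The number of tests costs
    \<open>3 / 2 * b\<close> and the potential \<open>b / 2\<close> in the exponent, so a single sum
    is at most \<open>2 * b / lam\<close>.\<close>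
  define lam where "lam = sqrt (b / real m)"
  have lam: "lam > 0" "lam\<^sup>2 * real m = b" using m b by (auto simp: lam_def)
  obtain \<epsilon> :: "nat \<Rightarrow> real" where \<epsilon>: "\<And>j. \<epsilon> j \<in> {1, -1}" and
    le: "(\<Sum>t\<in>T. cosh (lam * (\<Sum>j<m. \<epsilon> j * c t j))) \<le> real (card T) * exp (lam\<^sup>2 / 2) ^ m"
    using sign_choice_cosh[of T m c lam] T c by blast
  have "\<bar>\<Sum>j<m. \<epsilon> j * c t j\<bar> \<le> 2 * sqrt (b * real m)" if t: "t \<in> T" for t
  proof -
    define X where "X = (\<Sum>j<m. \<epsilon> j * c t j)"
    have "exp (lam * \<bar>X\<bar>) \<le> 2 * cosh (lam * \<bar>X\<bar>)"
      by (simp add: cosh_field_def)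
    also have "cosh (lam * \<bar>X\<bar>) = cosh (lam * X)"
      by (simp add: abs_if)
    also have "cosh (lam * X) \<le> (\<Sum>t\<in>T. cosh (lam * (\<Sum>j<m. \<epsilon> j * c t j)))"
      unfolding X_def by (rule member_le_sum[OF t]) (auto simp: T cosh_real_nonneg)
    also have "\<dots> \<le> real (card T) * exp (b / 2)"
      using le lam by (simp flip: exp_of_nat_mult add: mult.commute)
    finally have "exp (lam * \<bar>X\<bar>) \<le> (2 * real (card T)) * exp (b / 2)" by simp
    also have "\<dots> \<le> exp (3 / 2 * b) * exp (b / 2)"
      using b by (intro mult_right_mono) auto
    also have "\<dots> = exp (2 * b)" by (simp flip: exp_add)
    finally have "lam * \<bar>X\<bar> \<le> 2 * b" by simp
    then have "\<bar>X\<bar> \<le> 2 * (b / lam)" using lam by (simp add: field_simps)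
    also have "b / lam = sqrt (b * real m)"
      using m b lam by (simp add: lam_def real_sqrt_divide real_sqrt_mult real_div_sqrt field_simps)
    finally have "\<bar>X\<bar> \<le> 2 * sqrt (b * real m)" by simp
    then show ?thesis unfolding X_def .
  qed
  then show ?thesis using \<epsilon> by blast
qed

section \<open>Characters and their signed sums\<close>

definition echar :: "real \<Rightarrow> complex" where
  "echar x = cis (- (2 * pi * x))"

lemma echar_add: "echar (x + y) = echar x * echar y"
  by (simp add: echar_def cis_mult algebra_simps)

lemma echar_0 [simp]: "echar 0 = 1"
  by (simp add: echar_def)

lemma norm_echar [simp]: "norm (echar x) = 1"
  by (simp add: echar_def)

lemma echar_of_int [simp]: "echar (of_int k) = 1"
  using cis_multiple_2pi[of "- of_int k"] by (simp add: echar_def)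

lemma echar_of_nat [simp]: "echar (of_nat k) = 1"
  using echar_of_int[of "int k"] by simp

lemma norm_echar_minus_1: "norm (echar x - 1) \<le> 2 * pi * \<bar>x\<bar>"
  using iexp_approx1[of "- (2 * pi * x)" 0] by (simp add: echar_def cis_conv_exp abs_mult)

lemma norm_echar_diff: "norm (echar x - echar y) \<le> 2 * pi * \<bar>x - y\<bar>"
proof -
  have "echar x - echar y = echar y * (echar (x - y) - 1)"
    by (simp add: algebra_simps flip: echar_add)
  then show ?thesis using norm_echar_minus_1[of "x - y"] by (simp add: norm_mult)
qed

text \<open>
  The exponential sum is periodic in \<open>\<xi>\<close> with period \<open>2 ^ n\<close> and Lipschitz, so it suffices to
  control its real and imaginary parts at \<open>4 ^ n\<close> points.
\<close>
lemma sign_choice_exponential_sum: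
  fixes e :: "nat \<Rightarrow> nat"
  assumes m: "0 < m" "m \<le> 2 ^ n" and e: "\<And>j. j < m \<Longrightarrow> e j < 2 ^ n"
  shows "\<exists>\<epsilon>::nat \<Rightarrow> real. (\<forall>j. \<epsilon> j \<in> {1, -1}) \<and> (\<forall>j. e j \<in> P \<longrightarrow> \<epsilon> j = 1) \<and>
    (\<forall>\<xi>. norm (\<Sum>j<m. of_real (\<epsilon> j) * echar (\<xi> * (real (e j) / 2 ^ n)))
        \<le> 11 * sqrt ((real n + 1) * real m) + real (card {j. j < m \<and> e j \<in> P}))"
proof -
  \<comment> \<open>Prescribed signs get coefficient 0; their contribution is bounded separately, by
    their number.\<close>
  define c :: "bool \<times> nat \<Rightarrow> nat \<Rightarrow> real" where
    "c = (\<lambda>(z, k) j. if e j \<in> P then 0 else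
       (if z then Re else Im) (echar (real k / 2 ^ n * (real (e j) / 2 ^ n))))"
  define T :: "(bool \<times> nat) set" where "T = UNIV \<times> {..<4 ^ n}"
  have cardT: "card T = 2 * 4 ^ n" by (simp add: T_def card_cartesian_product)
  \<comment> \<open>The real and imaginary parts at \<open>4 ^ n\<close> points give
    \<open>2 * card T = 4 ^ (n + 1)\<close>, and 4 \<le> exp (3 / 2); this is why
    \<open>b = n + 1\<close> is admissible in \<open>sign_choice\<close>.\<close>
  have "2 * real (card T) \<le> exp (3 / 2 * (real n + 1))"
  proof -
    have e4: "(4::real) \<le> exp (3 / 2)"
    proof -
      have "ln (2::real) \<le> 3/4" using ln2_le_25_over_36 by simp
      then have "ln (4::real) \<le> 3 / 2" using ln_mult[of 2 "2::real"] by simp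
      then show ?thesis by (metis exp_le_cancel_iff exp_ln zero_less_numeral)
    qed
    have "2 * real (card T) = 4 ^ (n + 1)" by (simp add: cardT)
    also have "\<dots> \<le> exp (3 / 2) ^ (n + 1)" using e4 by (intro power_mono) auto
    also have "\<dots> = exp (3 / 2 * (real n + 1))"
      unfolding exp_of_nat_mult[symmetric] by (simp add: algebra_simps)
    finally show ?thesis .
  qed
  moreover have "\<bar>c t j\<bar> \<le> 1" for t j
    using abs_Re_le_cmod[of "echar (real (snd t) / 2 ^ n * (real (e j) / 2 ^ n))"]
      abs_Im_le_cmod[of "echar (real (snd t) / 2 ^ n * (real (e j) / 2 ^ n))"]
    by (cases t) (auto simp: c_def)
  moreover have "finite T" by (simp add: T_def)
  ultimately obtain \<epsilon> :: "nat \<Rightarrow> real" where \<epsilon>: "\<And>j. \<epsilon> j \<in> {1, -1}"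
    and small: "\<And>t. t \<in> T \<Longrightarrow> \<bar>\<Sum>j<m. \<epsilon> j * c t j\<bar> \<le> 2 * sqrt ((real n + 1) * real m)"
    using sign_choice[of T m c "real n + 1"] m(1) by (force simp del: Product_Type.split_paired_All split_paired_Ball_Sigma)
  define \<epsilon>' where "\<epsilon>' j = (if e j \<in> P then 1 else \<epsilon> j)" for j
  define d where "d j = (if e j \<in> P then 0 else \<epsilon> j)" for j
  define r where "r = sqrt ((real n + 1) * real m)"
  have r1: "1 \<le> r"
  proof -
    have "1 * 1 \<le> (real n + 1) * real m" using m by (intro mult_mono) auto
    then show ?thesis by (simp add: r_def)
  qed
  have "norm (\<Sum>j<m. of_real (\<epsilon>' j) * echar (\<xi> * (real (e j) / 2 ^ n)))
        \<le> 11 * r + real (card {j. j < m \<and> e j \<in> P})" for \<xi>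
  proof -
    define x where "x = \<xi> - of_int \<lfloor>\<xi> / 2 ^ n\<rfloor> * 2 ^ n"
    have x: "0 \<le> x" "x < 2 ^ n"
      using floor_divide_lower[of "2 ^ n" \<xi>] floor_divide_upper[of "2 ^ n" \<xi>]
      by (auto simp: x_def algebra_simps)
    define k where "k = nat \<lfloor>x * 2 ^ n\<rfloor>"
    have k: "real k \<le> x * 2 ^ n" "x * 2 ^ n < real k + 1"
      using x floor_correct[of "x * 2 ^ n"] by (auto simp: k_def)
    have "x * 2 ^ n < 2 ^ n * 2 ^ n" using x by (intro mult_strict_right_mono) auto
    also have "2 ^ n * 2 ^ n = (4::real) ^ n" by (simp flip: power_mult_distrib)
    finally have "real k < 4 ^ n" using k by linarith
    then have "k < 4 ^ n" by (metis of_nat_less_iff of_nat_numeral of_nat_power)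
    then have kT: "(z, k) \<in> T" for z
      by (simp add: T_def)
    have dk: "\<bar>x - real k / 2 ^ n\<bar> \<le> 1 / 2 ^ n"
    proof -
      have "real k / 2 ^ n \<le> x" using k by (simp add: pos_divide_le_eq)
      moreover have "x \<le> real k / 2 ^ n + 1 / 2 ^ n"
        using k by (simp add: pos_le_divide_eq flip: add_divide_distrib)
      ultimately show ?thesis by (simp add: abs_le_iff)
    qed
    have per: "echar (\<xi> * (real (e j) / 2 ^ n)) = echar (x * (real (e j) / 2 ^ n))" for j
    proof -
      have "\<xi> * (real (e j) / 2 ^ n)
          = x * (real (e j) / 2 ^ n) + of_int (\<lfloor>\<xi> / 2 ^ n\<rfloor> * int (e j))"
        by (simp add: x_def field_simps)
      then show ?thesis by (simp only: echar_add echar_of_int) simp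
    qed
    have split: "(\<Sum>j<m. of_real (\<epsilon>' j) * echar (\<xi> * (real (e j) / 2 ^ n)))
      = (\<Sum>j<m. of_real (d j) * (echar (x * (real (e j) / 2 ^ n)) - echar (real k / 2 ^ n * (real (e j) / 2 ^ n))))
        + (\<Sum>j<m. of_real (d j) * echar (real k / 2 ^ n * (real (e j) / 2 ^ n)))
        + (\<Sum>j<m. if e j \<in> P then echar (\<xi> * (real (e j) / 2 ^ n)) else 0)"
      unfolding per
      by (simp flip: sum.distrib, intro sum.cong)
         (auto simp: \<epsilon>'_def d_def algebra_simps)
    have "norm (\<Sum>j<m. of_real (d j) * (echar (x * (real (e j) / 2 ^ n)) - echar (real k / 2 ^ n * (real (e j) / 2 ^ n))))
        \<le> (\<Sum>j<m. 2 * pi / 2 ^ n)"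
    proof (rule sum_norm_le)
      fix j assume "j \<in> {..<m}"
      then have ej: "real (e j) / 2 ^ n \<le> 1" using e[of j] by (simp add: less_imp_le)
      have "\<bar>d j\<bar> \<le> 1" using \<epsilon>[of j] by (auto simp: d_def)
      moreover have "norm (echar (x * (real (e j) / 2 ^ n)) - echar (real k / 2 ^ n * (real (e j) / 2 ^ n)))
        \<le> 2 * pi / 2 ^ n"
      proof -
        have "\<bar>x * (real (e j) / 2 ^ n) - real k / 2 ^ n * (real (e j) / 2 ^ n)\<bar>
            = \<bar>x - real k / 2 ^ n\<bar> * (real (e j) / 2 ^ n)"
          by (simp only: left_diff_distrib[symmetric] abs_mult) simp
        also have "\<dots> \<le> 1 / 2 ^ n * 1"
          using dk ej by (intro mult_mono) auto
        finally have "2 * pi * \<bar>x * (real (e j) / 2 ^ n) - real k / 2 ^ n * (real (e j) / 2 ^ n)\<bar>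
          \<le> 2 * pi * (1 / 2 ^ n)" by (intro mult_left_mono) auto
        then show ?thesis using norm_echar_diff order_trans by fastforce
      qed
      ultimately have "\<bar>d j\<bar> * norm (echar (x * (real (e j) / 2 ^ n)) - echar (real k / 2 ^ n * (real (e j) / 2 ^ n)))
        \<le> 1 * (2 * pi / 2 ^ n)" by (intro mult_mono) auto
      then show "norm (of_real (d j) * (echar (x * (real (e j) / 2 ^ n)) - echar (real k / 2 ^ n * (real (e j) / 2 ^ n))))
        \<le> 2 * pi / 2 ^ n" by (simp add: norm_mult)
    qed
    also have "\<dots> = 2 * pi * (real m / 2 ^ n)" by simp
    \<comment> \<open>There are at most \<open>2 ^ n\<close> summands, each moved by at most
      \<open>2 * pi / 2 ^ n\<close>, so passing to the grid costs only a constant.\<close>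
    also have "\<dots> \<le> 2 * pi * 1"
    proof -
      have "real m \<le> 2 ^ n" using m(2) by (metis of_nat_le_iff of_nat_numeral of_nat_power)
      then show ?thesis by (intro mult_left_mono) auto
    qed
    \<comment> \<open>The constant 11 is this 7, from \<open>2 * pi\<close> and
      \<open>1 \<le> r\<close>, plus 2 each for the real and the imaginary part.\<close>
    also have "\<dots> \<le> 7 * r"
      using pi_less_4 r1 pi_approx by simp
    finally have 1: "norm (\<Sum>j<m. of_real (d j) * (echar (x * (real (e j) / 2 ^ n)) - echar (real k / 2 ^ n * (real (e j) / 2 ^ n)))) \<le> 7 * r" .
    have part: "(\<Sum>j<m. \<epsilon> j * c (z, k) j)
      = (if z then Re else Im) (\<Sum>j<m. of_real (d j) * echar (real k / 2 ^ n * (real (e j) / 2 ^ n)))" for z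
      by (auto simp: c_def d_def intro!: sum.cong)
    have "norm (\<Sum>j<m. of_real (d j) * echar (real k / 2 ^ n * (real (e j) / 2 ^ n))) \<le> 2 * r + 2 * r"
      using small[OF kT[of True]] small[OF kT[of False]] unfolding part r_def[symmetric]
      by (intro order_trans[OF cmod_le] add_mono) auto
    moreover have "norm (\<Sum>j<m. if e j \<in> P then echar (\<xi> * (real (e j) / 2 ^ n)) else 0)
      \<le> real (card {j. j < m \<and> e j \<in> P})"
    proof -
      have "norm (\<Sum>j<m. if e j \<in> P then echar (\<xi> * (real (e j) / 2 ^ n)) else 0)
        \<le> (\<Sum>j<m. if e j \<in> P then 1 else 0)"
        by (rule sum_norm_le) auto
      also have "\<dots> = real (card {j. j < m \<and> e j \<in> P})"
        by (simp add: sum.If_cases Int_def)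
      finally show ?thesis .
    qed
    ultimately show ?thesis
      unfolding split using 1
      by (intro order_trans[OF norm_triangle_ineq] order_trans[OF add_mono[OF order_trans[OF norm_triangle_ineq] order_refl]]) 
         (assumption | linarith | rule order_refl add_mono)+
  qed
  then show ?thesis using \<epsilon>
    by (intro exI[of _ \<epsilon>']) (auto simp: \<epsilon>'_def r_def)
qed

section \<open>Binary trees with a planted subtree\<close>

primrec cnt :: "nat set \<Rightarrow> nat \<Rightarrow> nat" where
  "cnt S 0 = 0"
| "cnt S (Suc n) = cnt S n + (if n \<in> S then 1 else 0)"

lemma cnt_le: "cnt S n \<le> n"
  by (induction n) auto

text \<open>The integers below \<open>2 ^ n\<close> whose digits, most significant first, vanish at the positions outside \<open>A\<close>.\<close>
primrec planted :: "nat set \<Rightarrow> nat \<Rightarrow> nat set" where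
  "planted A 0 = {0}"
| "planted A (Suc n) =
     (\<lambda>v. 2 * v) ` planted A n \<union> (if n \<in> A then (\<lambda>v. 2 * v + 1) ` planted A n else {})"

lemma finite_planted [simp]: "finite (planted A n)"
  by (induction n) auto

lemma double_disjoint: "(\<lambda>v::nat. 2 * v) ` B \<inter> (\<lambda>v. 2 * v + 1) ` B = {}"
  by (auto, presburger)

lemma inj_double: "inj_on (\<lambda>v::nat. 2 * v) B" "inj_on (\<lambda>v::nat. 2 * v + 1) B"
  by (auto simp: inj_on_def)

lemma card_planted: "card (planted A n) = 2 ^ cnt A n"
  by (induction n) (auto simp: card_Un_disjoint double_disjoint[simplified] card_image inj_double[simplified])

lemma sum_echar_planted:
  "(\<Sum>v\<in>planted A n. echar (\<xi> * (real v / 2 ^ n)))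
     = (\<Prod>k\<in>{k. k < n \<and> k \<in> A}. 1 + echar (\<xi> / 2 ^ Suc k))"
proof (induction n)
  case 0
  show ?case by simp
next
  case (Suc n)
  have even: "(\<Sum>v\<in>(\<lambda>v. 2 * v) ` planted A n. echar (\<xi> * (real v / 2 ^ Suc n)))
      = (\<Sum>v\<in>planted A n. echar (\<xi> * (real v / 2 ^ n)))"
    by (subst sum.reindex[OF inj_double(1)]) (simp add: o_def)
  have "\<xi> * (real (2 * v + 1) / 2 ^ Suc n) = \<xi> * (real v / 2 ^ n) + \<xi> / 2 ^ Suc n" for v
    by (simp add: field_simps)
  then have odd: "(\<Sum>v\<in>(\<lambda>v. 2 * v + 1) ` planted A n. echar (\<xi> * (real v / 2 ^ Suc n)))
      = (\<Sum>v\<in>planted A n. echar (\<xi> * (real v / 2 ^ n))) * echar (\<xi> / 2 ^ Suc n)"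
    by (subst sum.reindex[OF inj_double(2)])
       (simp only: o_def sum_distrib_right echar_add)
  have set_eq: "{k. k < Suc n \<and> k \<in> A} = (if n \<in> A then insert n {k. k < n \<and> k \<in> A} else {k. k < n \<and> k \<in> A})"
    by (auto simp: less_Suc_eq)
  have fin: "finite {k. k < n \<and> k \<in> A}" by simp
  show ?case
  proof (cases "n \<in> A")
    case True
    have "(\<Sum>v\<in>planted A (Suc n). echar (\<xi> * (real v / 2 ^ Suc n)))
      = (\<Sum>v\<in>planted A n. echar (\<xi> * (real v / 2 ^ n))) * (1 + echar (\<xi> / 2 ^ Suc n))"
      using True even odd double_disjoint[of "planted A n"]
      by (simp add: sum.union_disjoint distrib_left)
    then show ?thesis using True Suc.IH fin unfolding set_eq by (simp add: mult.commute)
  next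
    case False
    then show ?thesis using even Suc.IH unfolding set_eq by simp
  qed
qed

text \<open>
  Level \<open>n\<close> of the tree has \<open>2 ^ cnt S n\<close> nodes; \<open>e n j\<close> is the integer whose binary digits are the
  address of node \<open>j\<close>, which stands for the dyadic interval \<open>[e n j / 2 ^ n, (e n j + 1) / 2 ^ n]\<close>.
  Both children survive at the levels in \<open>S\<close>, only the child \<open>d n j\<close> at the others.
\<close>
locale binary_tree =
  fixes S :: "nat set" and e d :: "nat \<Rightarrow> nat \<Rightarrow> nat"
  assumes e_0: "e 0 j = 0"
    and e_keep: "n \<in> S \<Longrightarrow> e (Suc n) j = 2 * e n (j div 2) + j mod 2"
    and e_choose: "n \<notin> S \<Longrightarrow> e (Suc n) j = 2 * e n j + d n j"
    and d_le: "d n j \<le> 1"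
begin

lemma e_less: "e n j < 2 ^ n"
proof (induction n arbitrary: j)
  case 0
  show ?case by (simp add: e_0)
next
  case (Suc n)
  show ?case
    using Suc.IH[of j] Suc.IH[of "j div 2"] d_le[of n j] e_keep[of n j] e_choose[of n j]
    by (cases "n \<in> S") auto
qed

lemma inj_on_e: "inj_on (e n) {..<2 ^ cnt S n}"
proof (induction n)
  case 0
  show ?case by (auto simp: inj_on_def)
next
  case (Suc n)
  show ?case
  proof (rule inj_onI)
    fix i j assume ij: "i \<in> {..<2 ^ cnt S (Suc n)}" "j \<in> {..<2 ^ cnt S (Suc n)}"
      "e (Suc n) i = e (Suc n) j"
    show "i = j"
    proof (cases "n \<in> S")
      case True
      then have "2 * e n (i div 2) + i mod 2 = 2 * e n (j div 2) + j mod 2"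
        using ij by (simp add: e_keep)
      then have *: "e n (i div 2) = e n (j div 2)" "i mod 2 = j mod 2" by presburger+
      have "i div 2 = j div 2"
        by (rule inj_onD[OF Suc.IH *(1)]) (use ij True in auto)
      with *(2) show ?thesis by (metis div_mult_mod_eq)
    next
      case False
      then have "2 * e n i + d n i = 2 * e n j + d n j"
        using ij by (simp add: e_choose)
      then have "e n i = e n j" using d_le[of n i] d_le[of n j] by presburger
      then show ?thesis by (rule inj_onD[OF Suc.IH]) (use ij False in auto)
    qed
  qed
qed

end

text \<open>\<open>1 - 2 * d\<close> is the sign of the chosen child: 1 for the left one, -1 for the
  right one. Planted nodes have a forced sign and admit no cancellation; \<open>2 ^ cnt A n\<close>
  is their number.\<close>

locale salem_tree = binary_tree +
  fixes A :: "nat set"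
  assumes A_subset: "A \<subseteq> S"
    and d_planted: "n \<notin> S \<Longrightarrow> e n j \<in> planted A n \<Longrightarrow> d n j = 0"
    and discrepancy: "n \<notin> S \<Longrightarrow>
      norm (\<Sum>j<2 ^ cnt S n. of_real (1 - 2 * real (d n j)) * echar (\<xi> * (real (e n j) / 2 ^ n)))
        \<le> 11 * sqrt ((real n + 1) * 2 ^ cnt S n) + 2 ^ cnt A n"

lemma salem_tree_exists:
  assumes "A \<subseteq> S"
  shows "\<exists>e d. salem_tree S e d A"
proof -
  define good where "good n e' d' \<longleftrightarrow> (\<forall>j. d' j \<le> 1) \<and> (\<forall>j. e' j \<in> planted A n \<longrightarrow> d' j = 0) \<and>
      (\<forall>\<xi>. norm (\<Sum>j<2 ^ cnt S n. of_real (1 - 2 * real (d' j)) * echar (\<xi> * (real (e' j) / 2 ^ n)))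
        \<le> 11 * sqrt ((real n + 1) * 2 ^ cnt S n) + 2 ^ cnt A n)"
    for n :: nat and e' d' :: "nat \<Rightarrow> nat"
  \<comment> \<open>The default keeps \<open>d \<le> 1\<close> before any good choice is known to
    exist. This alone makes \<open>e\<close> a tree, and the bound on \<open>e n\<close> and its
    injectivity are then used to find the good choice.\<close>
  define pick where "pick n e' = (if \<exists>d'. good n e' d' then SOME d'. good n e' d' else (\<lambda>_. 0))"
    for n and e' :: "nat \<Rightarrow> nat"
  define e where "e = rec_nat (\<lambda>j. 0) (\<lambda>n e' j. if n \<in> S then 2 * e' (j div 2) + j mod 2
      else 2 * e' j + pick n e' j)"
  define d where "d n = pick n (e n)" for n
  have e_0: "e 0 j = 0" for j by (simp add: e_def)
  have e_Suc: "e (Suc n) j = (if n \<in> S then 2 * e n (j div 2) + j mod 2 else 2 * e n j + d n j)" for n j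
    by (simp add: e_def d_def)
  have d_le: "d n j \<le> 1" for n j
    using someI_ex[of "good n (e n)"] by (auto simp: d_def pick_def good_def simp del: One_nat_def)
  interpret binary_tree S e d
    by unfold_locales (auto simp: e_0 e_Suc d_le simp del: One_nat_def)
  have "\<exists>d'. good n (e n) d'" for n
  proof -
    have "(2::nat) ^ cnt S n \<le> 2 ^ n" by (intro power_increasing cnt_le) auto
    then obtain \<epsilon> :: "nat \<Rightarrow> real" where \<epsilon>: "\<And>j. \<epsilon> j \<in> {1, -1}" "\<And>j. e n j \<in> planted A n \<Longrightarrow> \<epsilon> j = 1"
      and bound: "\<And>\<xi>. norm (\<Sum>j<2 ^ cnt S n. of_real (\<epsilon> j) * echar (\<xi> * (real (e n j) / 2 ^ n)))
        \<le> 11 * sqrt ((real n + 1) * real (2 ^ cnt S n))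
          + real (card {j. j < 2 ^ cnt S n \<and> e n j \<in> planted A n})"
      using sign_choice_exponential_sum[of "2 ^ cnt S n" n "e n" "planted A n", OF _ _ e_less]
      by (meson zero_less_numeral zero_less_power)
    have "card {j. j < 2 ^ cnt S n \<and> e n j \<in> planted A n} \<le> card (planted A n)"
      by (rule card_inj_on_le[of "e n"]) (use inj_on_e[of n] in \<open>auto simp: inj_on_def\<close>)
    then have card: "real (card {j. j < 2 ^ cnt S n \<and> e n j \<in> planted A n}) \<le> 2 ^ cnt A n"
      by (simp add: card_planted)
    define d' where "d' j = (if \<epsilon> j = 1 then 0 else 1::nat)" for j
    have "1 - 2 * real (d' j) = \<epsilon> j" for j
      using \<epsilon>(1)[of j] by (auto simp: d'_def)
    then have "good n (e n) d'"
      unfolding good_def using \<epsilon>(2) bound card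
      by (force simp: d'_def intro: order_trans)
    then show ?thesis by (intro exI[of _ d'])
  qed
  then have good: "good n (e n) (d n)" for n
    using someI_ex[of "good n (e n)"] by (auto simp: d_def pick_def)
  have "salem_tree S e d A"
    by unfold_locales (use assms good in \<open>auto simp: good_def\<close>)
  then show ?thesis by blast
qed

section \<open>The uniform measure of a binary tree\<close>

abbreviation unit_lborel :: "real measure" where
  "unit_lborel \<equiv> restrict_space lborel {0..<1}"

lemma prob_space_unit_lborel: "prob_space unit_lborel"
  by (rule prob_spaceI) (simp add: space_restrict_space emeasure_restrict_space)

lemma floor_grid_iff:
  assumes "0 \<le> t" "t < 1" "M > 0" "j < M"
  shows "nat \<lfloor>real M * t\<rfloor> = j \<longleftrightarrow> t \<in> {real j / real M..<(real j + 1) / real M}"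
proof -
  have "nat \<lfloor>real M * t\<rfloor> = j \<longleftrightarrow> \<lfloor>real M * t\<rfloor> = int j"
    using assms by (simp add: nat_eq_iff)
  also have "\<dots> \<longleftrightarrow> t \<in> {real j / real M..<(real j + 1) / real M}"
    using assms by (auto simp: floor_eq_iff field_simps)
  finally show ?thesis .
qed

lemma floor_grid_less:
  assumes "0 \<le> t" "t < 1" "M > 0"
  shows "nat \<lfloor>real M * t\<rfloor> < M"
proof -
  have "real M * t < real M" using assms by simp
  then have "\<lfloor>real M * t\<rfloor> < int M" by (simp add: floor_less_iff)
  then show ?thesis using assms by (simp add: nat_less_iff)
qed

lemma integral_step:
  fixes G :: "nat \<Rightarrow> 'b::{banach, second_countable_topology}"
  assumes M: "M > 0"
  shows "(LINT t|unit_lborel. G (nat \<lfloor>real M * t\<rfloor>)) = (\<Sum>j<M. G j) /\<^sub>R real M"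
proof -
  define J where "J j = {real j / real M..<(real j + 1) / real M}" for j
  have J: "J j \<subseteq> {0..<1}" if "j < M" for j
  proof -
    have "real j + 1 \<le> real M" using that by simp
    then have "(real j + 1) / real M \<le> 1" using M by simp
    then show ?thesis by (auto simp: J_def intro: order_trans[OF divide_nonneg_nonneg])
  qed
  have sets_J: "J j \<in> sets lborel" for j by (simp add: J_def)
  have meas: "measure unit_lborel (J j) = 1 / real M" "J j \<in> sets unit_lborel" "emeasure unit_lborel (J j) < \<infinity>"
    if "j < M" for j
  proof -
    have le: "real j / real M \<le> (real j + 1) / real M" using M by (simp add: divide_right_mono)
    show "measure unit_lborel (J j) = 1 / real M"
      using J[OF that] le by (subst measure_restrict_space) (auto simp: J_def diff_divide_distrib[symmetric])
    show "J j \<in> sets unit_lborel"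
      using J[OF that] sets_J by (simp add: sets_restrict_space_iff)
    show "emeasure unit_lborel (J j) < \<infinity>"
      using J[OF that] le by (subst emeasure_restrict_space) (auto simp: J_def)
  qed
  have "(LINT t|unit_lborel. G (nat \<lfloor>real M * t\<rfloor>))
      = (LINT t|unit_lborel. (\<Sum>j<M. indicator (J j) t *\<^sub>R G j))"
  proof (rule Bochner_Integration.integral_cong[OF refl])
    fix t assume "t \<in> space unit_lborel"
    then have t: "0 \<le> t" "t < 1" by (auto simp: space_restrict_space)
    have "(\<Sum>j<M. indicator (J j) t *\<^sub>R G j) = (\<Sum>j<M. if j = nat \<lfloor>real M * t\<rfloor> then G j else 0)"
      using floor_grid_iff[OF t M] by (intro sum.cong) (auto simp: J_def indicator_def)
    also have "\<dots> = G (nat \<lfloor>real M * t\<rfloor>)"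
      using floor_grid_less[OF t M] by (simp add: sum.delta)
    finally show "G (nat \<lfloor>real M * t\<rfloor>) = (\<Sum>j<M. indicator (J j) t *\<^sub>R G j)" ..
  qed
  also have "\<dots> = (\<Sum>j<M. LINT t|unit_lborel. indicator (J j) t *\<^sub>R G j)"
    using meas by (intro Bochner_Integration.integral_sum) auto
  also have "\<dots> = (\<Sum>j<M. G j /\<^sub>R real M)"
    using meas J by (intro sum.cong) (auto simp: divide_inverse space_restrict_space Int_absorb2)
  finally show ?thesis by (simp add: scaleR_sum_right)
qed

lemma floor_double_div_2: "nat \<lfloor>2 * y\<rfloor> div 2 = nat \<lfloor>y :: real\<rfloor>"
proof -
  have "\<lfloor>2 * y\<rfloor> div 2 = \<lfloor>y\<rfloor>" using floor_divide_real_eq_div[of 2 "2 * y"] by simp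
  then show ?thesis by (metis nat_div_distrib' nat_numeral zero_le_numeral)
qed

lemma measurable_echar [measurable]: "echar \<in> borel_measurable borel"
  unfolding echar_def by (intro borel_measurable_continuous_onI continuous_intros)

text \<open>
  With \<open>t\<close> uniform on \<open>[0, 1)\<close>, the node \<open>idx n t\<close> is uniform on level \<open>n\<close> and these nodes form a branch
  of the tree, because \<open>\<lfloor>2 y\<rfloor> div 2 = \<lfloor>y\<rfloor>\<close>. Hence the law of the limit point \<open>X t\<close> gives every
  node of level \<open>n\<close> the same mass.
\<close>
context binary_tree
begin

definition idx :: "nat \<Rightarrow> real \<Rightarrow> nat" where
  "idx n t = nat \<lfloor>real (2 ^ cnt S n) * t\<rfloor>"

definition Xn :: "nat \<Rightarrow> real \<Rightarrow> real" where
  "Xn n t = real (e n (idx n t)) / 2 ^ n"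

definition X :: "real \<Rightarrow> real" where
  "X t = lim (\<lambda>n. Xn n t)"

definition \<mu> :: "real measure" where
  "\<mu> = distr unit_lborel borel X"

definition cell :: "nat \<Rightarrow> nat \<Rightarrow> real set" where
  "cell n v = {real v / 2 ^ n..(real v + 1) / 2 ^ n}"

definition E :: "real set" where
  "E = (\<Inter>n. \<Union>j<2 ^ cnt S n. cell n (e n j))"

lemma idx_less: "0 \<le> t \<Longrightarrow> t < 1 \<Longrightarrow> idx n t < 2 ^ cnt S n"
  unfolding idx_def by (rule floor_grid_less) auto

lemma idx_keep: "n \<in> S \<Longrightarrow> idx (Suc n) t div 2 = idx n t"
  using floor_double_div_2[of "2 ^ cnt S n * t"] by (simp add: idx_def mult_ac)

lemma idx_choose: "n \<notin> S \<Longrightarrow> idx (Suc n) t = idx n t"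
  by (simp add: idx_def)

lemma e_idx_Suc:
  "e (Suc n) (idx (Suc n) t) \<in> {2 * e n (idx n t), 2 * e n (idx n t) + 1}"
proof (cases "n \<in> S")
  case True
  then show ?thesis by (auto simp: e_keep idx_keep)
next
  case False
  then show ?thesis using d_le[of n "idx n t"] by (auto simp: e_choose idx_choose le_Suc_eq)
qed

lemma Xn_Suc: "Xn n t \<le> Xn (Suc n) t" "Xn (Suc n) t + 1 / 2 ^ Suc n \<le> Xn n t + 1 / 2 ^ n"
  using e_idx_Suc[of n t] by (auto simp: Xn_def field_simps)

lemma incseq_Xn: "incseq (\<lambda>n. Xn n t)"
  by (intro incseq_SucI Xn_Suc)

lemma decseq_Xn: "decseq (\<lambda>n. Xn n t + 1 / 2 ^ n)"
  by (intro decseq_SucI Xn_Suc)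

lemma Xn_LIMSEQ: "(\<lambda>n. Xn n t) \<longlonglongrightarrow> X t"
proof -
  have "Xn n t \<le> 1" for n
    using decseqD[OF decseq_Xn, of 0 n t] by (simp add: Xn_def e_0 add_increasing2 order_trans[rotated])
  then have "convergent (\<lambda>n. Xn n t)"
    using incseq_convergent[OF incseq_Xn, of t 1] by (metis convergentI)
  then show ?thesis unfolding X_def by (simp add: convergent_LIMSEQ_iff)
qed

lemma Xn_le_X: "Xn n t \<le> X t"
  by (rule incseq_le[OF incseq_Xn Xn_LIMSEQ])

lemma X_le_Xn: "X t \<le> Xn n t + 1 / 2 ^ n"
proof -
  have "(\<lambda>n. Xn n t + (1 / 2) ^ n) \<longlonglongrightarrow> X t + 0"
    by (intro tendsto_add Xn_LIMSEQ LIMSEQ_realpow_zero) auto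
  then have "(\<lambda>n. Xn n t + 1 / 2 ^ n) \<longlonglongrightarrow> X t" by (simp add: power_one_over)
  then show ?thesis by (rule decseq_ge[OF decseq_Xn])
qed

lemma X_in_cell: "X t \<in> cell n (e n (idx n t))"
  using Xn_le_X[of n t] X_le_Xn[of t n] by (simp add: cell_def Xn_def add_divide_distrib)

lemma measurable_idx [measurable]: "idx n \<in> borel \<rightarrow>\<^sub>M count_space UNIV"
  unfolding idx_def by measurable

lemma measurable_Xn [measurable]: "Xn n \<in> borel_measurable borel"
  unfolding Xn_def by measurable

lemma measurable_X [measurable]: "X \<in> borel_measurable borel"
  by (rule borel_measurable_LIMSEQ_real[OF Xn_LIMSEQ]) measurable

lemma measurable_unit [measurable_dest]: "f \<in> borel \<rightarrow>\<^sub>M N \<Longrightarrow> f \<in> unit_lborel \<rightarrow>\<^sub>M N"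
  by (intro measurable_restrict_space1) simp

lemma sets_mu: "sets \<mu> = sets borel"
  by (simp add: \<mu>_def)

lemma prob_space_mu: "prob_space \<mu>"
  unfolding \<mu>_def by (rule prob_space.prob_space_distr[OF prob_space_unit_lborel]) (rule measurable_unit[OF measurable_X])

lemma measure_mu:
  assumes "B \<in> sets borel"
  shows "measure \<mu> B = measure unit_lborel {t \<in> {0..<1}. X t \<in> B}"
  unfolding \<mu>_def using assms
  by (subst measure_distr) (auto simp: space_restrict_space measurable_unit intro!: arg_cong[where f = "measure unit_lborel"])

lemma unit_set_idx [measurable]: "{t \<in> {0..<1}. idx n t \<in> J} \<in> sets unit_lborel"
proof -
  have "{t \<in> space unit_lborel. idx n t \<in> J} \<in> sets unit_lborel"
    using measurable_unit[OF measurable_idx[of n]] by measurable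
  then show ?thesis by (simp add: space_restrict_space)
qed

lemma unit_set_X [measurable]: "B \<in> sets borel \<Longrightarrow> {t \<in> {0..<1}. X t \<in> B} \<in> sets unit_lborel"
proof -
  assume [measurable]: "B \<in> sets borel"
  have "{t \<in> space unit_lborel. X t \<in> B} \<in> sets unit_lborel"
    using measurable_unit[OF measurable_X] by measurable
  then show ?thesis by (simp add: space_restrict_space)
qed

lemma measure_idx:
  "measure unit_lborel {t \<in> {0..<1}. idx n t \<in> J} = real (card ({..<2 ^ cnt S n} \<inter> J)) / 2 ^ cnt S n"
proof -
  have "measure unit_lborel {t \<in> {0..<1}. idx n t \<in> J}
      = (LINT t|unit_lborel. indicator {t \<in> {0..<1}. idx n t \<in> J} t)"
    using sets.Int_space_eq2[OF unit_set_idx[of n J]] by simp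
  also have "\<dots> = (LINT t|unit_lborel. indicator J (nat \<lfloor>real (2 ^ cnt S n) * t\<rfloor>))"
    by (intro Bochner_Integration.integral_cong) (auto simp: indicator_def idx_def space_restrict_space)
  also have "\<dots> = (\<Sum>j<2 ^ cnt S n. indicator J j) /\<^sub>R real (2 ^ cnt S n)"
    by (subst integral_step) auto
  also have "(\<Sum>j<2 ^ cnt S n. indicator J j) = real (card ({..<2 ^ cnt S n} \<inter> J))"
    by (simp add: indicator_def sum.If_cases)
  finally show ?thesis by (simp add: divide_inverse)
qed

lemma compact_E: "compact E"
proof -
  have "compact (\<Union>j<2 ^ cnt S n. cell n (e n j))" for n
    by (intro compact_UN) (auto simp: cell_def)
  then have "closed E" unfolding E_def by (intro closed_INT) (auto intro: compact_imp_closed)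
  moreover have "E \<subseteq> {0..1}"
    unfolding E_def by (rule INF_lower2[of 0]) (auto simp: cell_def e_0)
  ultimately show ?thesis
    by (metis bounded_closed_interval bounded_subset box_real(2) bounded_cbox compact_eq_bounded_closed)
qed

lemma X_in_E: "0 \<le> t \<Longrightarrow> t < 1 \<Longrightarrow> X t \<in> E"
  using X_in_cell[of t] idx_less[of t] by (auto simp: E_def)

lemma measure_E: "measure \<mu> E = 1"
proof -
  have "E \<in> sets borel" using compact_E by (rule borel_compact)
  moreover have "{t \<in> {0..<1}. X t \<in> E} = space unit_lborel"
    using X_in_E by (auto simp: space_restrict_space)
  ultimately show ?thesis
    using prob_space.prob_space[OF prob_space_unit_lborel] by (simp add: measure_mu)
qed

section \<open>Mass of intervals and of single points\<close>

lemma finite_measure_unit: "finite_measure unit_lborel"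
  using prob_space_unit_lborel by (rule prob_space.finite_measure)

lemma measure_ge:
  assumes x: "x \<in> E" and r: "1 / 2 ^ n < r" and B: "{x - r<..<x + r} \<subseteq> B" "B \<in> sets borel"
  shows "1 / 2 ^ cnt S n \<le> measure \<mu> B"
proof -
  obtain j where j: "j < 2 ^ cnt S n" "x \<in> cell n (e n j)"
    using x by (auto simp: E_def)
  have "cell n (e n j) \<subseteq> B"
    using j r B(1) by (auto simp: cell_def add_divide_distrib)
  then have sub: "{t \<in> {0..<1}. idx n t \<in> {j}} \<subseteq> {t \<in> {0..<1}. X t \<in> B}"
    using X_in_cell by fastforce
  have "1 / 2 ^ cnt S n = measure unit_lborel {t \<in> {0..<1}. idx n t \<in> {j}}"
    using j by (subst measure_idx) simp
  also have "\<dots> \<le> measure unit_lborel {t \<in> {0..<1}. X t \<in> B}"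
    by (rule finite_measure.finite_measure_mono[OF finite_measure_unit sub unit_set_X[OF B(2)]])
  finally show ?thesis using B by (simp add: measure_mu)
qed

text \<open>Distinct nodes have distinct cells, and an interval no longer than a cell meets at most
  three of them: three and not two, because closed cells that only touch it are counted.\<close>

lemma measure_le:
  assumes r: "r \<le> 1 / 2 ^ n" and B: "B \<subseteq> {a..a + r}" "B \<in> sets borel"
  shows "measure \<mu> B \<le> 3 / 2 ^ cnt S n"
proof -
  define k where "k = \<lceil>a * 2 ^ n\<rceil> - 1"
  define J where "J = {j. int (e n j) \<in> {k..k + 2}}"
  have sub: "{t \<in> {0..<1}. X t \<in> B} \<subseteq> {t \<in> {0..<1}. idx n t \<in> J}"
  proof safe
    fix t assume "X t \<in> B" "t \<in> {0..<1::real}"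
    then have "a \<le> X t" "X t \<le> a + 1 / 2 ^ n" using B r by auto
    then have "a \<le> (real (e n (idx n t)) + 1) / 2 ^ n" "real (e n (idx n t)) / 2 ^ n \<le> a + 1 / 2 ^ n"
      using X_in_cell[of t n] by (auto simp: cell_def)
    then have "a * 2 ^ n \<le> real (e n (idx n t)) + 1" "real (e n (idx n t)) \<le> a * 2 ^ n + 1"
      by (auto simp: field_simps)
    then show "idx n t \<in> J" unfolding J_def k_def by simp linarith
  qed
  have "measure \<mu> B \<le> measure unit_lborel {t \<in> {0..<1}. idx n t \<in> J}"
    unfolding measure_mu[OF B(2)]
    by (rule finite_measure.finite_measure_mono[OF finite_measure_unit sub unit_set_idx])
  also have "\<dots> = real (card ({..<2 ^ cnt S n} \<inter> J)) / 2 ^ cnt S n"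
    by (rule measure_idx)
  also have "card ({..<2 ^ cnt S n} \<inter> J) \<le> card {k..k + 2}"
    by (rule card_inj_on_le[of "\<lambda>j. int (e n j)"])
       (use inj_on_e[of n] in \<open>auto simp: inj_on_def J_def\<close>)
  finally show ?thesis by (simp add: divide_right_mono)
qed

text \<open>Points have no mass, so the endpoints shared by neighbouring cells may be ignored when
  events about \<open>X\<close> are turned into events about \<open>idx\<close>.\<close>

lemma measure_mu_point:
  assumes "\<And>K. \<exists>n. cnt S n \<ge> K"
  shows "measure \<mu> {x} = 0"
proof -
  have "measure \<mu> {x} \<le> \<delta>" if pos: "\<delta> > 0" for \<delta>
  proof -
    obtain K where K: "(1 / 2) ^ K < \<delta> / 3" 
      using real_arch_pow_inv[of "\<delta> / 3" "1 / 2"] pos by auto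
    obtain n where n: "cnt S n \<ge> K" using assms by blast
    have "measure \<mu> {x} \<le> 3 * (1 / 2) ^ cnt S n"
      using measure_le[of 0 n "{x}" x] by (simp add: power_one_over)
    also have "\<dots> \<le> 3 * (1 / 2) ^ K" using n by (intro mult_left_mono power_decreasing) auto
    finally show ?thesis using K by simp
  qed
  then have "measure \<mu> {x} \<le> 0" by (rule field_le_epsilon) simp
  then show ?thesis by (simp add: measure_le_0_iff)
qed

text \<open>Adjacent cells share an endpoint, hence only an almost-everywhere statement.\<close>
lemma AE_X_cell:
  assumes "\<And>K. \<exists>n. cnt S n \<ge> K"
  shows "AE t in unit_lborel. \<forall>v. X t \<in> cell n v \<longleftrightarrow> e n (idx n t) = v"
proof -
  have "AE t in unit_lborel. X t \<noteq> real v / 2 ^ n" for v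
  proof -
    have "measure unit_lborel {t \<in> {0..<1}. X t \<in> {real v / 2 ^ n}} = 0"
      using measure_mu_point[OF assms, of "real v / 2 ^ n"] by (simp add: measure_mu)
    then have "emeasure unit_lborel {t \<in> {0..<1}. X t \<in> {real v / 2 ^ n}} = 0"
      by (simp add: finite_measure.emeasure_eq_measure[OF finite_measure_unit])
    then show ?thesis
      by (intro AE_I[of _ _ "{t \<in> {0..<1}. X t \<in> {real v / 2 ^ n}}"] unit_set_X)
         (auto simp: space_restrict_space)
  qed
  then have "AE t in unit_lborel. \<forall>v::nat. X t \<noteq> real v / 2 ^ n" by (simp add: AE_all_countable)
  then show ?thesis
  proof eventually_elim
    case (elim t)
    have cell: "X t \<in> cell n (e n (idx n t))" by (rule X_in_cell)
    show ?case
    proof (intro allI iffI)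
      fix v assume "X t \<in> cell n v"
      then have v: "real v / 2 ^ n < X t" "X t < real (v + 1) / 2 ^ n"
        using elim[rule_format, of v] elim[rule_format, of "v + 1"] by (auto simp: cell_def add.commute)
      have e: "real (e n (idx n t)) / 2 ^ n < X t" "X t < real (e n (idx n t) + 1) / 2 ^ n"
        using cell elim[rule_format, of "e n (idx n t)"] elim[rule_format, of "e n (idx n t) + 1"]
        by (auto simp: cell_def add.commute)
      have "real v < real (e n (idx n t) + 1)" "real (e n (idx n t)) < real (v + 1)"
        using less_trans[OF v(1) e(2)] less_trans[OF e(1) v(2)] by (auto simp: divide_less_cancel)
      then show "e n (idx n t) = v" by linarith
    qed (use cell in simp)
  qed
qed

text \<open>\<open>X\<close> differs from the left endpoint \<open>Xn n\<close> of its cell by at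
  most \<open>1 / 2 ^ n\<close>. The error is kept proportional to the mean of
  \<open>\<bar>g\<bar>\<close>: applied to the planted part, whose mass is tiny, an error relative
  to the total mass could swamp the main term.\<close>

lemma echar_X_integral:
  fixes g :: "nat \<Rightarrow> real"
  shows "norm ((LINT t|unit_lborel. of_real (g (idx n t)) * echar (\<xi> * X t))
      - (\<Sum>j<2 ^ cnt S n. of_real (g j) * echar (\<xi> * (real (e n j) / 2 ^ n))) / 2 ^ cnt S n)
    \<le> 2 * pi * \<bar>\<xi>\<bar> / 2 ^ n * ((\<Sum>j<2 ^ cnt S n. \<bar>g j\<bar>) / 2 ^ cnt S n)"
proof -
  interpret prob_space unit_lborel by (rule prob_space_unit_lborel)
  have meas1 [measurable]: "X \<in> borel_measurable unit_lborel" "Xn n \<in> borel_measurable unit_lborel"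
    "idx n \<in> unit_lborel \<rightarrow>\<^sub>M count_space UNIV"
    by (intro measurable_unit measurable_X measurable_Xn measurable_idx)+
  have bound: "\<bar>g (idx n t)\<bar> \<le> (\<Sum>j<2 ^ cnt S n. \<bar>g j\<bar>)" if "t \<in> space unit_lborel" for t
    by (rule member_le_sum) (use that idx_less[of t n] in \<open>auto simp: space_restrict_space\<close>)
  have int_g: "integrable unit_lborel (\<lambda>t. g (idx n t))"
    using bound by (intro integrable_const_bound[where B = "\<Sum>j<2 ^ cnt S n. \<bar>g j\<bar>"] AE_I2) auto
  have int: "integrable unit_lborel (\<lambda>t. of_real (g (idx n t)) * echar (\<xi> * Y t))"
    if [measurable]: "Y \<in> borel_measurable unit_lborel" for Y
    using bound by (intro integrable_const_bound[where B = "\<Sum>j<2 ^ cnt S n. \<bar>g j\<bar>"] AE_I2) (auto simp: norm_mult)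
  have "(\<Sum>j<2 ^ cnt S n. of_real (g j) * echar (\<xi> * (real (e n j) / 2 ^ n))) / 2 ^ cnt S n
      = (LINT t|unit_lborel. of_real (g (idx n t)) * echar (\<xi> * Xn n t))"
    unfolding Xn_def idx_def by (subst integral_step) (auto simp: scaleR_conv_of_real divide_inverse)
  then have "norm ((LINT t|unit_lborel. of_real (g (idx n t)) * echar (\<xi> * X t))
      - (\<Sum>j<2 ^ cnt S n. of_real (g j) * echar (\<xi> * (real (e n j) / 2 ^ n))) / 2 ^ cnt S n)
      = norm (LINT t|unit_lborel. of_real (g (idx n t)) * echar (\<xi> * X t) - of_real (g (idx n t)) * echar (\<xi> * Xn n t))"
    using int[of X] int[of "Xn n"] by (subst Bochner_Integration.integral_diff) auto
  also have "\<dots> \<le> (LINT t|unit_lborel. \<bar>g (idx n t)\<bar> * (2 * pi * \<bar>\<xi>\<bar> / 2 ^ n))"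
  proof (rule order_trans[OF integral_norm_bound], rule integral_mono)
    fix t
    have "norm (echar (\<xi> * X t) - echar (\<xi> * Xn n t)) \<le> 2 * pi * (\<bar>\<xi>\<bar> * (1 / 2 ^ n))"
    proof -
      have "\<bar>\<xi> * X t - \<xi> * Xn n t\<bar> = \<bar>\<xi>\<bar> * \<bar>X t - Xn n t\<bar>" by (simp add: abs_mult flip: right_diff_distrib)
      also have "\<dots> \<le> \<bar>\<xi>\<bar> * (1 / 2 ^ n)"
        using Xn_le_X[of n t] X_le_Xn[of t n] by (intro mult_left_mono) auto
      finally show ?thesis
        by (intro order_trans[OF norm_echar_diff] mult_left_mono) auto
    qed
    then have "\<bar>g (idx n t)\<bar> * norm (echar (\<xi> * X t) - echar (\<xi> * Xn n t)) \<le> \<bar>g (idx n t)\<bar> * (2 * pi * \<bar>\<xi>\<bar> / 2 ^ n)"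
      by (intro mult_left_mono) auto
    then show "norm (of_real (g (idx n t)) * echar (\<xi> * X t) - of_real (g (idx n t)) * echar (\<xi> * Xn n t))
      \<le> \<bar>g (idx n t)\<bar> * (2 * pi * \<bar>\<xi>\<bar> / 2 ^ n)"
      by (simp add: norm_mult flip: right_diff_distrib)
  qed (use int[of X] int[of "Xn n"] int_g in \<open>auto intro!: integrable_norm\<close>)
  also have "\<dots> = 2 * pi * \<bar>\<xi>\<bar> / 2 ^ n * ((\<Sum>j<2 ^ cnt S n. \<bar>g j\<bar>) / 2 ^ cnt S n)"
    unfolding idx_def by (subst integral_step) (auto simp: divide_inverse sum_distrib_left sum_distrib_right mult_ac)
  finally show ?thesis .
qed

end

section \<open>Fourier decay\<close>

text \<open>The Fourier transform of the uniform distribution on \<open>[0, 1]\<close>, except for the junk value \<open>0\<close> at \<open>0\<close>.\<close>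
definition kern :: "real \<Rightarrow> complex" where
  "kern z = (1 - echar z) / (2 * of_real pi * \<i> * of_real z)"

text \<open>The uniform law on [0, 1] is the average of those on its two halves, which are
  translates of each other. The junk value keeps the identity true at 0.\<close>

lemma kern_double:
  "kern z = kern (z / 2) * ((1 + echar (z / 2)) / 2)"
proof -
  have "1 - echar z = (1 - echar (z / 2)) * (1 + echar (z / 2))"
    using echar_add[of "z / 2" "z / 2"] by (simp add: algebra_simps)
  then show ?thesis by (simp add: kern_def field_simps)
qed

lemma norm_kern_le_1: "norm (kern z) \<le> 1"
proof (cases "z = 0")
  case False
  then show ?thesis
    using norm_echar_minus_1[of z] by (simp add: kern_def norm_divide norm_mult norm_minus_commute)
qed (simp add: kern_def)

lemma norm_kern_le: "norm (kern z) \<le> 1 / (pi * \<bar>z\<bar>)"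
proof (cases "z = 0")
  case False
  have "norm (1 - echar z) \<le> 2"
    using norm_triangle_ineq4[of 1 "echar z"] by simp
  then show ?thesis using False
    by (simp add: kern_def norm_divide norm_mult field_simps)
qed (simp add: kern_def)

lemma norm_kern_minus_1:
  assumes "z \<noteq> 0"
  shows "norm (kern z - 1) \<le> pi * \<bar>z\<bar>"
proof -
  have "norm (echar z - 1 + 2 * of_real pi * \<i> * of_real z) \<le> (2 * pi * \<bar>z\<bar>)\<^sup>2 / 2"
    using iexp_approx1[of "- (2 * pi * z)" 1]
    by (simp add: echar_def cis_conv_exp abs_mult power2_eq_square algebra_simps)
  moreover have "kern z - 1 = - (echar z - 1 + 2 * of_real pi * \<i> * of_real z) / (2 * of_real pi * \<i> * of_real z)"
    using assms by (simp add: kern_def field_simps)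
  ultimately show ?thesis using assms
    by (simp only: norm_divide norm_minus_cancel) (simp add: norm_mult field_simps power2_eq_square)
qed

lemma sqrt_mult_divide:
  fixes a M :: real
  assumes "M > 0"
  shows "sqrt (a * M) / M = sqrt (a / M)"
proof -
  have "sqrt (a * M) / M = sqrt (a * M) / sqrt (M\<^sup>2)" using assms by simp
  also have "\<dots> = sqrt (a * M / M\<^sup>2)" by (rule real_sqrt_divide[symmetric])
  also have "a * M / M\<^sup>2 = a / M" using assms by (simp add: power2_eq_square)
  finally show ?thesis .
qed

lemma sum_lessThan_add: "sum f {..<m + n} = sum f {..<m} + (\<Sum>i<n. f (m + i))"
  for f :: "nat \<Rightarrow> 'a::comm_monoid_add"
  by (induction n) (auto simp: add.assoc)

lemma power2_bracket:
  fixes x :: real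
  assumes "1 \<le> x"
  obtains N where "2 ^ N \<le> x" "x < 2 ^ Suc N"
proof -
  define m where "m = (LEAST m. x < 2 ^ m)"
  have lt: "x < 2 ^ m" unfolding m_def by (rule LeastI_ex) (rule real_arch_pow, simp)
  then have "m \<noteq> 0" using assms by (intro notI) auto
  then obtain k where k: "m = Suc k" by (cases m) auto
  have "\<not> x < 2 ^ k" using not_less_Least[of k "\<lambda>m. x < 2 ^ m"] k by (simp add: m_def)
  then show ?thesis using lt by (intro that[of k]) (auto simp: k)
qed

text \<open>The terms rise with ratio \<open>2 powr (1 - b)\<close> until \<open>2 ^ k\<close>
  reaches about \<open>x\<close> and then fall with ratio \<open>2 powr (- 1 - b)\<close>. As b < 1,
  both sides are geometric and comparable to the peak \<open>x powr (- b)\<close>.\<close>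

lemma two_sided_geometric_sum:
  fixes b x :: real
  assumes b: "0 < b" "b < 1" and x: "1 \<le> x"
  shows "(\<Sum>k<n. (2 ^ k) powr (- b) * min (2 ^ k / x) (2 * x / 2 ^ k))
    \<le> (2 powr (1 - b) / (2 powr (1 - b) - 1) + 2 / (1 - 2 powr (- 1 - b))) * x powr (- b)"
proof -
  define f where "f k = (2 ^ k) powr (- b) * min (2 ^ k / x) (2 * x / 2 ^ k)" for k :: nat
  define \<rho> where "\<rho> = 2 powr (1 - b)"
  define \<eta> where "\<eta> = 2 powr (- 1 - b)"
  have \<rho>: "\<rho> > 1" using b by (simp add: \<rho>_def)
  have \<eta>: "0 < \<eta>" "\<eta> < 1"
    using b by (auto simp: \<eta>_def intro: order_less_le_trans[OF powr_less_mono[of _ 0]])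
  have pw: "\<rho> ^ k = (2 ^ k) powr (1 - b)" "\<eta> ^ k = (2 ^ k) powr (- 1 - b)" for k
    by (simp_all add: \<rho>_def \<eta>_def powr_powr mult.commute flip: powr_realpow)
  have f_nonneg: "f k \<ge> 0" for k using x by (simp add: f_def)
  have f1: "f k \<le> \<rho> ^ k / x" for k
  proof -
    have "f k \<le> (2 ^ k) powr (- b) * (2 ^ k / x)" unfolding f_def by (intro mult_left_mono) auto
    also have "\<dots> = \<rho> ^ k / x" by (simp add: pw powr_diff powr_minus field_simps)
    finally show ?thesis .
  qed
  have f2: "f k \<le> 2 * x * \<eta> ^ k" for k
  proof -
    have "f k \<le> (2 ^ k) powr (- b) * (2 * x / 2 ^ k)" unfolding f_def by (intro mult_left_mono) auto
    also have "\<dots> = 2 * x * \<eta> ^ k" by (simp add: pw powr_diff powr_minus field_simps)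
    finally show ?thesis .
  qed
  obtain N where N: "2 ^ N \<le> x" "x < 2 ^ Suc N"
    using power2_bracket[OF x] .
  have "sum f {..<Suc N} \<le> (\<Sum>k<Suc N. \<rho> ^ k / x)" by (intro sum_mono f1)
  also have "\<dots> = (\<Sum>k<Suc N. \<rho> ^ k) / x" by (rule sum_divide_distrib[symmetric])
  also have "\<dots> = (\<rho> ^ Suc N - 1) / (\<rho> - 1) / x"
    using \<rho> by (subst geometric_sum) auto
  also have "\<dots> \<le> \<rho> ^ Suc N / (\<rho> - 1) / x"
    using \<rho> x by (intro divide_right_mono) auto
  also have "\<dots> = \<rho> / (\<rho> - 1) * (\<rho> ^ N / x)" by simp
  also have "\<dots> \<le> \<rho> / (\<rho> - 1) * x powr (- b)"
  proof (intro mult_left_mono)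
    have "\<rho> ^ N \<le> x powr (1 - b)"
      unfolding pw using N b by (intro powr_mono2) auto
    then have "\<rho> ^ N / x \<le> x powr (1 - b) / x" using x by (intro divide_right_mono) auto
    also have "\<dots> = x powr (- b)" using x by (simp add: powr_diff powr_minus_divide)
    finally show "\<rho> ^ N / x \<le> x powr (- b)" .
  qed (use \<rho> in auto)
  finally have low: "sum f {..<Suc N} \<le> \<rho> / (\<rho> - 1) * x powr (- b)" .
  have "(\<Sum>i<n. f (Suc N + i)) \<le> (\<Sum>i<n. 2 * x * \<eta> ^ (Suc N + i))" by (intro sum_mono f2)
  also have "\<dots> = (2 * x * \<eta> ^ Suc N) * (\<Sum>i<n. \<eta> ^ i)"
    by (simp only: power_add sum_distrib_left mult.assoc)
  also have "\<dots> \<le> (2 * x * x powr (- 1 - b)) * (1 / (1 - \<eta>))"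
  proof (intro mult_mono mult_left_mono)
    show "(\<Sum>i<n. \<eta> ^ i) \<le> 1 / (1 - \<eta>)"
      using \<eta> by (simp add: sum_gp_strict divide_right_mono)
    show "\<eta> ^ Suc N \<le> x powr (- 1 - b)"
      unfolding pw using N b x by (intro powr_mono2') auto
  qed (use x \<eta> in \<open>auto intro!: sum_nonneg\<close>)
  also have "\<dots> = 2 / (1 - \<eta>) * (x * x powr (- 1 - b))" by simp
  also have "x * x powr (- 1 - b) = x powr (- b)"
    using x by (simp add: powr_diff powr_minus_divide)
  finally have high: "(\<Sum>i<n. f (Suc N + i)) \<le> 2 / (1 - \<eta>) * x powr (- b)" .
  have "sum f {..<n} \<le> sum f {..<Suc N + n}"
    by (rule sum_mono2) (auto simp: f_nonneg)
  also have "\<dots> = sum f {..<Suc N} + (\<Sum>i<n. f (Suc N + i))" by (rule sum_lessThan_add)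
  also have "\<dots> \<le> \<rho> / (\<rho> - 1) * x powr (- b) + 2 / (1 - \<eta>) * x powr (- b)"
    by (intro add_mono low high)
  also have "\<dots> = (\<rho> / (\<rho> - 1) + 2 / (1 - \<eta>)) * x powr (- b)" by (rule distrib_right[symmetric])
  finally show ?thesis unfolding f_def \<rho>_def \<eta>_def .
qed

section \<open>Telescoping over the levels\<close>

context salem_tree
begin

definition avg :: "nat \<Rightarrow> real \<Rightarrow> complex" where
  "avg n \<xi> = (\<Sum>j<2 ^ cnt S n. echar (\<xi> * (real (e n j) / 2 ^ n))) / 2 ^ cnt S n"

lemma norm_avg_le_1: "norm (avg n \<xi>) \<le> 1"
proof -
  have "norm (\<Sum>j<2 ^ cnt S n. echar (\<xi> * (real (e n j) / 2 ^ n))) \<le> (\<Sum>j<(2::nat) ^ cnt S n. 1)"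
    by (rule sum_norm_le) simp
  then show ?thesis by (simp add: avg_def norm_divide norm_power)
qed

lemma sum_double: "(\<Sum>j<2 * m. f j) = (\<Sum>j<m. f (2 * j) + f (2 * j + 1))"
  for f :: "nat \<Rightarrow> 'c::comm_monoid_add"
  by (induction m) (auto simp: add.assoc)

lemma avg_keep:
  assumes "n \<in> S"
  shows "avg (Suc n) \<xi> = avg n \<xi> * ((1 + echar (\<xi> / 2 ^ Suc n)) / 2)"
proof -
  have *: "\<xi> * (real (2 * v + 1) / 2 ^ Suc n) = \<xi> * (real v / 2 ^ n) + \<xi> / 2 ^ Suc n"
    "\<xi> * (real (2 * v) / 2 ^ Suc n) = \<xi> * (real v / 2 ^ n)" for v
    by (simp_all add: field_simps)
  have "(\<Sum>j<2 * 2 ^ cnt S n. echar (\<xi> * (real (e (Suc n) j) / 2 ^ Suc n)))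
      = (\<Sum>j<2 ^ cnt S n. echar (\<xi> * (real (e n j) / 2 ^ n)) * (1 + echar (\<xi> / 2 ^ Suc n)))"
  proof (subst sum_double, intro sum.cong refl)
    fix j
    have "e (Suc n) (2 * j) = 2 * e n j" "e (Suc n) (2 * j + 1) = 2 * e n j + 1"
      using assms by (simp_all add: e_keep)
    then show "echar (\<xi> * (real (e (Suc n) (2 * j)) / 2 ^ Suc n)) + echar (\<xi> * (real (e (Suc n) (2 * j + 1)) / 2 ^ Suc n))
      = echar (\<xi> * (real (e n j) / 2 ^ n)) * (1 + echar (\<xi> / 2 ^ Suc n))"
      by (simp only: * echar_add distrib_left mult_1_right)
  qed
  then show ?thesis using assms by (simp add: avg_def sum_distrib_right)
qed

text \<open>A child chosen with sign 1 or -1 is the average of both children plus that sign times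
  half their difference. The average is what a level in \<open>S\<close> would give; only the
  difference carries the signs.\<close>

lemma avg_choose:
  assumes "n \<notin> S"
  shows "avg (Suc n) \<xi> = avg n \<xi> * ((1 + echar (\<xi> / 2 ^ Suc n)) / 2)
    + (\<Sum>j<2 ^ cnt S n. of_real (1 - 2 * real (d n j)) * echar (\<xi> * (real (e n j) / 2 ^ n))) / 2 ^ cnt S n
      * ((1 - echar (\<xi> / 2 ^ Suc n)) / 2)"
proof -
  define w where "w = echar (\<xi> / 2 ^ Suc n)"
  have *: "\<xi> * (real (2 * v + 1) / 2 ^ Suc n) = \<xi> * (real v / 2 ^ n) + \<xi> / 2 ^ Suc n"
    "\<xi> * (real (2 * v) / 2 ^ Suc n) = \<xi> * (real v / 2 ^ n)" for v
    by (simp_all add: field_simps)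
  have "echar (\<xi> * (real (e (Suc n) j) / 2 ^ Suc n))
     = echar (\<xi> * (real (e n j) / 2 ^ n)) * ((1 + w) / 2)
       + of_real (1 - 2 * real (d n j)) * echar (\<xi> * (real (e n j) / 2 ^ n)) * ((1 - w) / 2)" for j
  proof (cases "d n j = 0")
    case True
    then have "e (Suc n) j = 2 * e n j" using assms by (simp add: e_choose)
    then show ?thesis by (simp only: * True) (simp add: field_simps)
  next
    case False
    then have d: "d n j = 1" using d_le[of n j] by simp
    then have "e (Suc n) j = 2 * e n j + 1" using assms by (simp add: e_choose)
    then show ?thesis by (simp only: * d echar_add w_def[symmetric]) (simp add: field_simps)
  qed
  then have "(\<Sum>j<2 ^ cnt S n. echar (\<xi> * (real (e (Suc n) j) / 2 ^ Suc n)))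
    = (\<Sum>j<2 ^ cnt S n. echar (\<xi> * (real (e n j) / 2 ^ n))) * ((1 + w) / 2)
      + (\<Sum>j<2 ^ cnt S n. of_real (1 - 2 * real (d n j)) * echar (\<xi> * (real (e n j) / 2 ^ n))) * ((1 - w) / 2)"
    by (simp only: sum.distrib sum_distrib_right)
  then show ?thesis using assms by (simp add: avg_def w_def add_divide_distrib)
qed

text \<open>
  \<open>avg n \<xi> * kern (\<xi> / 2 ^ n)\<close> is the transform of the measure of level \<open>n\<close> spread uniformly over its
  intervals. It does not change at levels in \<open>S\<close>, and otherwise changes by a signed sum of transforms
  of Haar functions.
\<close>
lemma smoothed_avg_step:
  assumes \<xi>: "\<xi> \<noteq> 0" and K: "11 * sqrt ((real n + 1) / 2 ^ cnt S n) + 2 ^ cnt A n / 2 ^ cnt S n \<le> K"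
  shows "norm (avg (Suc n) \<xi> * kern (\<xi> / 2 ^ Suc n) - avg n \<xi> * kern (\<xi> / 2 ^ n))
    \<le> K * min (2 ^ n / \<bar>\<xi>\<bar>) (2 * \<bar>\<xi>\<bar> / 2 ^ n)"
proof -
  have K0: "K \<ge> 0" using K by (rule order_trans[rotated]) simp
  have kern: "kern (\<xi> / 2 ^ n) = kern (\<xi> / 2 ^ Suc n) * ((1 + echar (\<xi> / 2 ^ Suc n)) / 2)"
    using kern_double[of "\<xi> / 2 ^ n"] by (simp add: field_simps)
  show ?thesis
  proof (cases "n \<in> S")
    case True
    then show ?thesis using K0 by (simp add: avg_keep kern)
  next
    case False
    define W where "W = (\<Sum>j<2 ^ cnt S n. of_real (1 - 2 * real (d n j)) * echar (\<xi> * (real (e n j) / 2 ^ n)))"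
    have "avg (Suc n) \<xi> * kern (\<xi> / 2 ^ Suc n) - avg n \<xi> * kern (\<xi> / 2 ^ n)
      = W / 2 ^ cnt S n * (kern (\<xi> / 2 ^ Suc n) * ((1 - echar (\<xi> / 2 ^ Suc n)) / 2))"
      unfolding avg_choose[OF False] kern W_def by (simp add: algebra_simps)
    moreover have "norm (W / 2 ^ cnt S n) \<le> K"
    proof -
      have "norm (W / 2 ^ cnt S n) \<le> (11 * sqrt ((real n + 1) * 2 ^ cnt S n) + 2 ^ cnt A n) / 2 ^ cnt S n"
        using discrepancy[OF False, of \<xi>] by (simp add: W_def norm_divide norm_power divide_right_mono)
      also have "\<dots> = 11 * sqrt ((real n + 1) / 2 ^ cnt S n) + 2 ^ cnt A n / 2 ^ cnt S n"
        by (subst add_divide_distrib) (simp only: times_divide_eq_right[symmetric] sqrt_mult_divide zero_less_power zero_less_numeral)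
      finally show ?thesis using K by simp
    qed
    \<comment> \<open>A Haar function at scale \<open>1 / 2 ^ n\<close> lives at frequencies near
      \<open>2 ^ n\<close>: above them the decay of \<open>kern\<close> helps, below them the mean
      zero, visible as the factor with \<open>1 - echar\<close>.\<close>
    moreover have "norm (kern (\<xi> / 2 ^ Suc n) * ((1 - echar (\<xi> / 2 ^ Suc n)) / 2))
      \<le> min (2 ^ n / \<bar>\<xi>\<bar>) (2 * \<bar>\<xi>\<bar> / 2 ^ n)"
    proof (rule min.boundedI)
      have half: "norm ((1 - echar (\<xi> / 2 ^ Suc n)) / 2) \<le> 1"
        using norm_triangle_ineq4[of 1 "echar (\<xi> / 2 ^ Suc n)"] by (simp add: norm_divide)
      have "norm (kern (\<xi> / 2 ^ Suc n)) * norm ((1 - echar (\<xi> / 2 ^ Suc n)) / 2) \<le> 1 / (pi * \<bar>\<xi> / 2 ^ Suc n\<bar>) * 1"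
        by (intro mult_mono norm_kern_le half) auto
      also have "\<dots> = 2 / pi * (2 ^ n / \<bar>\<xi>\<bar>)" by (simp add: abs_divide)
      also have "\<dots> \<le> 1 * (2 ^ n / \<bar>\<xi>\<bar>)" using pi_ge_two by (intro mult_right_mono) auto
      finally show "norm (kern (\<xi> / 2 ^ Suc n) * ((1 - echar (\<xi> / 2 ^ Suc n)) / 2)) \<le> 2 ^ n / \<bar>\<xi>\<bar>"
        by (simp add: norm_mult)
      have "norm (kern (\<xi> / 2 ^ Suc n)) * norm ((1 - echar (\<xi> / 2 ^ Suc n)) / 2) \<le> 1 * (2 * pi * \<bar>\<xi> / 2 ^ Suc n\<bar> / 2)"
        using norm_echar_minus_1[of "\<xi> / 2 ^ Suc n"]
        by (intro mult_mono norm_kern_le_1) (auto simp: norm_divide norm_minus_commute)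
      also have "\<dots> = pi / 2 * (\<bar>\<xi>\<bar> / 2 ^ n)" by (simp add: abs_divide)
      also have "\<dots> \<le> 2 * (\<bar>\<xi>\<bar> / 2 ^ n)" using pi_less_4 by (intro mult_right_mono) auto
      finally show "norm (kern (\<xi> / 2 ^ Suc n) * ((1 - echar (\<xi> / 2 ^ Suc n)) / 2)) \<le> 2 * \<bar>\<xi>\<bar> / 2 ^ n"
        by (simp add: norm_mult)
    qed
    ultimately show ?thesis
      using mult_mono[of _ K _ "min (2 ^ n / \<bar>\<xi>\<bar>) (2 * \<bar>\<xi>\<bar> / 2 ^ n)", OF _ _ K0 norm_ge_zero]
      by (simp only: norm_mult[of "W / 2 ^ cnt S n"])
  qed
qed

text \<open>Level 0 is the uniform law on [0, 1], whose transform decays like 1 / |\<xi>|. Each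
  later level k adds a correction of size \<open>(2 ^ k) powr (- b)\<close> concentrated at
  frequencies near \<open>2 ^ k\<close>, so the sum is governed by the level with
  \<open>2 ^ k\<close> about |\<xi>|.\<close>

lemma smoothed_avg_decay:
  assumes b: "0 < b" "b < 1"
    and K: "\<And>n. 11 * sqrt ((real n + 1) / 2 ^ cnt S n) + 2 ^ cnt A n / 2 ^ cnt S n \<le> K * (2 ^ n) powr (- b)"
  shows "\<exists>C. \<forall>\<xi> n. 1 \<le> \<bar>\<xi>\<bar> \<longrightarrow> norm (avg n \<xi> * kern (\<xi> / 2 ^ n)) \<le> C * \<bar>\<xi>\<bar> powr (- b)"
proof -
  define C0 where "C0 = 2 powr (1 - b) / (2 powr (1 - b) - 1) + 2 / (1 - 2 powr (- 1 - b))"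
  have K0: "K \<ge> 0" using K[of 0] by (simp add: order_trans[rotated])
  have "norm (avg n \<xi> * kern (\<xi> / 2 ^ n)) \<le> (1 + K * C0) * \<bar>\<xi>\<bar> powr (- b)" if \<xi>: "1 \<le> \<bar>\<xi>\<bar>" for \<xi> n
  proof -
    have "norm (avg n \<xi> * kern (\<xi> / 2 ^ n))
      \<le> norm (avg 0 \<xi> * kern (\<xi> / 2 ^ 0)) + (\<Sum>k<n. K * (2 ^ k) powr (- b) * min (2 ^ k / \<bar>\<xi>\<bar>) (2 * \<bar>\<xi>\<bar> / 2 ^ k))"
    proof (induction n)
      case (Suc n)
      have "norm (avg (Suc n) \<xi> * kern (\<xi> / 2 ^ Suc n))
        \<le> norm (avg n \<xi> * kern (\<xi> / 2 ^ n)) + norm (avg (Suc n) \<xi> * kern (\<xi> / 2 ^ Suc n) - avg n \<xi> * kern (\<xi> / 2 ^ n))"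
        by (rule norm_triangle_sub)
      then show ?case using Suc.IH smoothed_avg_step[OF _ K, of \<xi> n] \<xi> by force
    qed simp
    also have "norm (avg 0 \<xi> * kern (\<xi> / 2 ^ 0)) \<le> \<bar>\<xi>\<bar> powr (- b)"
    proof -
      have "norm (avg 0 \<xi> * kern (\<xi> / 2 ^ 0)) \<le> 1 * (1 / (pi * \<bar>\<xi>\<bar>))"
        unfolding norm_mult using norm_kern_le[of \<xi>] by (intro mult_mono norm_avg_le_1) auto
      also have "\<dots> \<le> 1 / \<bar>\<xi>\<bar>" using \<xi> pi_ge_two by (simp add: divide_simps)
      also have "\<dots> = \<bar>\<xi>\<bar> powr (- 1)" using \<xi> by (simp add: powr_minus_divide)
      also have "\<dots> \<le> \<bar>\<xi>\<bar> powr (- b)" using \<xi> b by (intro powr_mono) auto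
      finally show ?thesis .
    qed
    also have "(\<Sum>k<n. K * (2 ^ k) powr (- b) * min (2 ^ k / \<bar>\<xi>\<bar>) (2 * \<bar>\<xi>\<bar> / 2 ^ k))
      = K * (\<Sum>k<n. (2 ^ k) powr (- b) * min (2 ^ k / \<bar>\<xi>\<bar>) (2 * \<bar>\<xi>\<bar> / 2 ^ k))"
      by (simp add: sum_distrib_left mult.assoc)
    also have "\<dots> \<le> K * (C0 * \<bar>\<xi>\<bar> powr (- b))"
      unfolding C0_def using two_sided_geometric_sum[OF b \<xi>] K0 by (intro mult_left_mono) auto
    finally show ?thesis by (simp add: algebra_simps)
  qed
  then show ?thesis by blast
qed

end

section \<open>Positions of the digits\<close>

text \<open>
  Block \<open>i\<close> of digit positions starts at \<open>T i\<close>. Its first \<open>\<rho> i\<close> positions lie in \<open>S - A\<close>, the ones from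
  there up to \<open>\<upsilon> i\<close> in \<open>A\<close>, the remaining ones outside \<open>S\<close>. With this order the counts of \<open>S\<close> and
  \<open>S - A\<close> run ahead of their linear targets inside a block, which is the harmless direction for the
  upper mass bound and for the Fourier decay.
\<close>
locale digit_blocks =
  fixes T \<rho> \<upsilon> :: "nat \<Rightarrow> nat"
  assumes T_0: "T 0 = 0"
    and \<rho>_ge: "3 \<le> \<rho> i"
    and \<rho>_le: "\<rho> i \<le> \<upsilon> i"
    and \<upsilon>_le: "T i + \<upsilon> i \<le> T (Suc i)"
begin

text \<open>The offset \<sigma> is a parameter so that one counting lemma serves \<open>S\<close>,
  \<open>A\<close> and the complement of \<open>Free\<close>.\<close>

definition Tail :: "(nat \<Rightarrow> nat) \<Rightarrow> nat set" where
  "Tail \<sigma> = {k. \<exists>i. T i + \<sigma> i \<le> k \<and> k < T i + \<upsilon> i}"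

definition S :: "nat set" where "S = Tail (\<lambda>_. 0)"
definition A :: "nat set" where "A = Tail \<rho>"

lemma T_less_Suc: "T i < T (Suc i)"
  using \<upsilon>_le[of i] \<rho>_le[of i] \<rho>_ge[of i] by linarith

lemma strict_mono_T: "strict_mono T"
  by (simp add: strict_mono_Suc_iff T_less_Suc)

lemma T_ge: "3 * l \<le> T l"
proof (induction l)
  case (Suc l)
  then show ?case using \<upsilon>_le[of l] \<rho>_le[of l] \<rho>_ge[of l] unfolding mult_Suc_right by linarith
qed simp

lemma block_exists: "\<exists>i d. n = T i + d \<and> d < T (Suc i) - T i"
proof (induction n)
  case 0
  show ?case using T_less_Suc[of 0] by (intro exI[of _ 0]) (auto simp: T_0)
next
  case (Suc n)
  then obtain i d where id: "n = T i + d" "d < T (Suc i) - T i" by blast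
  show ?case
  proof (cases "Suc d < T (Suc i) - T i")
    case True
    then show ?thesis using id by (intro exI[of _ i] exI[of _ "Suc d"]) auto
  next
    case False
    then have "Suc n = T (Suc i)" using id by linarith
    then show ?thesis using T_less_Suc[of "Suc i"] by (intro exI[of _ "Suc i"] exI[of _ 0]) auto
  qed
qed

lemma mem_Tail:
  assumes "d < T (Suc i) - T i"
  shows "T i + d \<in> Tail \<sigma> \<longleftrightarrow> \<sigma> i \<le> d \<and> d < \<upsilon> i"
proof
  assume "T i + d \<in> Tail \<sigma>"
  then obtain j where j: "T j + \<sigma> j \<le> T i + d" "T i + d < T j + \<upsilon> j" by (auto simp: Tail_def)
  have "j = i"
  proof (rule ccontr)
    assume "j \<noteq> i"
    then consider "Suc j \<le> i" | "Suc i \<le> j" by linarith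
    then show False
    proof cases
      case 1
      then have "T (Suc j) \<le> T i" using strict_mono_T by (simp add: strict_mono_less_eq)
      then show False using j \<upsilon>_le[of j] by linarith
    next
      case 2
      then have "T (Suc i) \<le> T j" using strict_mono_T by (simp add: strict_mono_less_eq)
      then show False using j assms by linarith
    qed
  qed
  then show "\<sigma> i \<le> d \<and> d < \<upsilon> i" using j by simp
next
  assume "\<sigma> i \<le> d \<and> d < \<upsilon> i"
  then show "T i + d \<in> Tail \<sigma>" unfolding Tail_def by (intro CollectI exI[of _ i]) simp
qed

lemma cnt_Tail:
  assumes "\<sigma> i \<le> \<upsilon> i" "d \<le> T (Suc i) - T i"
  shows "cnt (Tail \<sigma>) (T i + d) = cnt (Tail \<sigma>) (T i) + (min d (\<upsilon> i) - \<sigma> i)"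
  using assms(2)
proof (induction d)
  case (Suc d)
  then have d: "d < T (Suc i) - T i" by simp
  show ?case using Suc assms(1) by (auto simp: mem_Tail[OF d])
qed simp

lemma cnt_Tail_Suc:
  assumes "\<sigma> i \<le> \<upsilon> i"
  shows "cnt (Tail \<sigma>) (T (Suc i)) = cnt (Tail \<sigma>) (T i) + (\<upsilon> i - \<sigma> i)"
proof -
  have "T (Suc i) = T i + (T (Suc i) - T i)" "\<upsilon> i \<le> T (Suc i) - T i" using \<upsilon>_le[of i] by auto
  then show ?thesis using cnt_Tail[of \<sigma> i "T (Suc i) - T i"] assms by (simp add: min_absorb2)
qed

lemma A_subset_S: "A \<subseteq> S"
  unfolding A_def S_def Tail_def by (auto intro: add_leD1)

end

section \<open>Block lengths and digit counts\<close>

lemma log2_linear_bound: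
  fixes \<epsilon> :: real
  assumes "\<epsilon> > 0"
  obtains K where "K \<ge> 0" "\<And>d. d \<ge> 0 \<Longrightarrow> log 2 (1 + d) \<le> \<epsilon> * d + K"
proof -
  define \<eta> where "\<eta> = \<epsilon> * ln 2"
  have \<eta>: "\<eta> > 0" using assms by (simp add: \<eta>_def)
  define K where "K = \<bar>\<eta> - 1 - ln \<eta>\<bar> / ln 2"
  have "log 2 (1 + d) \<le> \<epsilon> * d + K" if "d \<ge> 0" for d :: real
  proof -
    have "ln (\<eta> * (1 + d)) \<le> \<eta> * (1 + d) - 1"
      using \<eta> that by (intro ln_le_minus_one) (auto intro: mult_pos_pos)
    also have "ln (\<eta> * (1 + d)) = ln \<eta> + ln (1 + d)" using \<eta> that by (simp add: ln_mult)
    finally have "ln (1 + d) \<le> \<eta> * d + \<bar>\<eta> - 1 - ln \<eta>\<bar>"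
      by (simp add: distrib_left)
    then have "ln (1 + d) / ln 2 \<le> (\<eta> * d + \<bar>\<eta> - 1 - ln \<eta>\<bar>) / ln 2"
      by (intro divide_right_mono) auto
    then show ?thesis by (simp add: log_def K_def \<eta>_def add_divide_distrib)
  qed
  then show ?thesis by (intro that[of K]) (auto simp: K_def)
qed

lemma power_floor_log2_le:
  fixes y :: real
  assumes "y > 0"
  shows "2 ^ nat \<lfloor>log 2 y\<rfloor> \<le> max 1 y"
proof (cases "y \<ge> 1")
  case True
  then have "real (nat \<lfloor>log 2 y\<rfloor>) \<le> log 2 y" by simp
  then have "2 powr real (nat \<lfloor>log 2 y\<rfloor>) \<le> 2 powr (log 2 y)" by (intro powr_mono) auto
  then show ?thesis using assms by (simp add: powr_realpow)
next
  case False
  then have "log 2 y < 0" using assms by simp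
  then have "nat \<lfloor>log 2 y\<rfloor> = 0" by simp
  then show ?thesis by simp
qed

text \<open>The counts are prescribed up to rounding at the block ends, and inside a block they
  exceed their targets by at most its length. Lengths about \<open>log 2 \<phi>\<close> satisfy two
  opposite demands: two to the length is at most a multiple of \<phi>, and the lengths tend to
  infinity, so that the number of blocks is negligible against \<open>T l\<close>. \<phi> is
  evaluated at \<open>2 ^ n / 4\<close> because the lower mass bound for intervals of length r will
  use a level with \<open>2 ^ n \<le> 4 / r\<close>; n \<ge> 3 keeps this argument in the domain [2,
  \<infinity>).\<close>

lemma digit_blocks_exist:
  fixes \<alpha> \<beta> :: real and \<phi> :: "real \<Rightarrow> real" and \<gamma> :: nat
  assumes ab: "0 < \<beta>" "\<beta> \<le> \<alpha>" "\<alpha> < 1" and \<gamma>: "\<gamma> \<le> 1"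
    and \<phi>_pos: "\<And>t. t \<ge> 2 \<Longrightarrow> \<phi> t > 0" and \<phi>_mono: "mono_on {2..} \<phi>"
    and \<phi>_lim: "filterlim \<phi> at_top at_top"
  obtains T \<rho> \<upsilon> C where "digit_blocks T \<rho> \<upsilon>" "0 < C"
    "\<And>n. (2 ^ n) powr \<alpha> * (real n + 1) ^ \<gamma> \<le> C * 2 ^ cnt (digit_blocks.S T \<upsilon>) n"
    "\<And>n. n \<ge> 3 \<Longrightarrow> 2 ^ cnt (digit_blocks.S T \<upsilon>) n \<le> C * ((2 ^ n) powr \<alpha> * (real n + 1) ^ \<gamma> * \<phi> (2 ^ n / 4))"
    "\<And>n. \<beta> / 2 * real n \<le> real (cnt (digit_blocks.S T \<upsilon>) n) - real (cnt (digit_blocks.A T \<rho> \<upsilon>) n)"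
    "\<And>l. real (cnt (digit_blocks.S T \<upsilon>) (T l)) \<le> \<alpha> * real (T l) + log 2 (1 + real (T l)) + 1"
    "\<And>l. real (cnt (digit_blocks.S T \<upsilon>) (T l)) - real (cnt (digit_blocks.A T \<rho> \<upsilon>) (T l)) \<le> \<beta> / 2 * real (T l) + 1"
    "\<And>\<epsilon>. \<epsilon> > 0 \<Longrightarrow> \<exists>K. \<forall>l. real l \<le> K + \<epsilon> * real (T l)"
proof -
  obtain K where K: "K \<ge> 0" "\<And>d. d \<ge> 0 \<Longrightarrow> log 2 (1 + d) \<le> (1 - \<alpha>) / 2 * d + K"
    using log2_linear_bound[of "(1 - \<alpha>) / 2"] ab by auto
  \<comment> \<open>The first bound leaves a block room for all its positions in \<open>S\<close>,
    including the growth of the logarithm and rounding. The second gives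
    \<open>4 \<le> \<beta> / 2 * B\<close>, hence after rounding at least three positions of
    \<open>S - A\<close> per block.\<close>
  define B0 where "B0 = nat \<lceil>max (2 * (K + 1) / (1 - \<alpha>)) (8 / \<beta>)\<rceil>"
  have B0: "2 * (K + 1) / (1 - \<alpha>) \<le> real B0" "8 / \<beta> \<le> real B0"
    unfolding B0_def by linarith+
  have B0_log: "\<alpha> * real B + log 2 (1 + real B) + 1 \<le> real B" if "B0 \<le> B" for B
  proof -
    have "2 * (K + 1) / (1 - \<alpha>) \<le> real B" using B0(1) that by linarith
    then have "2 * (K + 1) \<le> (1 - \<alpha>) * real B" using ab by (simp add: field_simps)
    moreover have "log 2 (1 + real B) \<le> (1 - \<alpha>) * real B / 2 + K" using K(2)[of "real B"] by simp
    ultimately have "log 2 (1 + real B) + 1 \<le> (1 - \<alpha>) * real B" by argo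
    then show ?thesis by (simp add: algebra_simps)
  qed
  have B0_\<beta>: "4 \<le> \<beta> / 2 * real B" if "B0 \<le> B" for B
  proof -
    have "8 / \<beta> \<le> real B" using B0(2) that by linarith
    then show ?thesis using ab by (simp add: field_simps)
  qed
  \<comment> \<open>Within a block \<open>cnt S\<close> may exceed its target by the block length, so \<open>\<phi>\<close> has to pay for \<open>2 ^ B t\<close>.\<close>
  define B where "B t = B0 + (if t \<ge> 3 then nat \<lfloor>log 2 (\<phi> (2 ^ t / 4))\<rfloor> else 0)" for t :: nat
  have B_ge: "B0 \<le> B t" for t by (simp add: B_def)
  define T where "T = rec_nat 0 (\<lambda>_ t. t + B t)"
  have T_0: "T 0 = 0" and T_Suc: "T (Suc i) = T i + B (T i)" for i by (simp_all add: T_def)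
  define \<Lambda> where "\<Lambda> x = real \<gamma> * log 2 (1 + x)" for x :: real
  have \<Lambda>_nonneg: "0 \<le> \<Lambda> x" if "x \<ge> 0" for x using that by (simp add: \<Lambda>_def)
  have \<Lambda>_mono: "\<Lambda> x \<le> \<Lambda> y" if "0 \<le> x" "x \<le> y" for x y
    using that by (simp add: \<Lambda>_def mult_left_mono)
  have \<Lambda>_add: "\<Lambda> (x + y) \<le> \<Lambda> x + log 2 (1 + y)" if "0 \<le> x" "0 \<le> y" for x y
  proof -
    have "1 + (x + y) \<le> (1 + x) * (1 + y)" using that by (simp add: algebra_simps)
    then have "log 2 (1 + (x + y)) \<le> log 2 ((1 + x) * (1 + y))" using that by (subst log_le_cancel_iff) auto
    also have "\<dots> = log 2 (1 + x) + log 2 (1 + y)" using that by (simp add: log_mult)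
    finally have "real \<gamma> * log 2 (1 + (x + y)) \<le> real \<gamma> * (log 2 (1 + x) + log 2 (1 + y))"
      by (intro mult_left_mono) auto
    also have "\<dots> \<le> real \<gamma> * log 2 (1 + x) + 1 * log 2 (1 + y)"
      unfolding distrib_left using \<gamma> that by (intro add_left_mono mult_right_mono) auto
    finally show ?thesis by (simp add: \<Lambda>_def)
  qed
  have \<Lambda>_powr: "2 powr \<Lambda> (real n) = (real n + 1) ^ \<gamma>" for n
    using \<gamma> by (cases \<gamma>) (auto simp: \<Lambda>_def add.commute)
  \<comment> \<open>The targets at block starts: \<open>u\<close> for the positions in
    \<open>S\<close>, \<open>r\<close> for those in \<open>S - A\<close>. Rounding up preserves the
    lower bounds on both counts.\<close>
  define u where "u i = nat \<lceil>\<alpha> * real (T i) + \<Lambda> (real (T i))\<rceil>" for i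
  define r where "r i = nat \<lceil>\<beta> / 2 * real (T i)\<rceil>" for i
  have u: "\<alpha> * real (T i) + \<Lambda> (real (T i)) \<le> real (u i)" "real (u i) \<le> \<alpha> * real (T i) + \<Lambda> (real (T i)) + 1" for i
  proof -
    have "0 \<le> \<alpha> * real (T i) + \<Lambda> (real (T i))" using ab \<Lambda>_nonneg by (simp add: add_nonneg_nonneg)
    then show "\<alpha> * real (T i) + \<Lambda> (real (T i)) \<le> real (u i)" "real (u i) \<le> \<alpha> * real (T i) + \<Lambda> (real (T i)) + 1"
      unfolding u_def by linarith+
  qed
  have r: "\<beta> / 2 * real (T i) \<le> real (r i)" "real (r i) \<le> \<beta> / 2 * real (T i) + 1" for i
  proof -
    have "0 \<le> \<beta> / 2 * real (T i)" using ab by simp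
    then show "\<beta> / 2 * real (T i) \<le> real (r i)" "real (r i) \<le> \<beta> / 2 * real (T i) + 1"
      unfolding r_def by linarith+
  qed
  have T_Suc_real: "real (T (Suc i)) = real (T i) + real (B (T i))" for i by (simp add: T_Suc)
  have r_diff: "real (r i) + 3 \<le> real (r (Suc i))" "real (r (Suc i)) - real (r i) \<le> \<beta> / 2 * real (B (T i)) + 1" for i
    using r[of i] r[of "Suc i"] B0_\<beta>[OF B_ge, of "T i"] unfolding T_Suc_real by (auto simp: algebra_simps)
  have u_diff: "\<alpha> * real (B (T i)) - 1 \<le> real (u (Suc i)) - real (u i)"
    "real (u (Suc i)) - real (u i) \<le> real (B (T i))" for i
  proof -
    have "\<Lambda> (real (T i)) \<le> \<Lambda> (real (T (Suc i)))" unfolding T_Suc_real by (intro \<Lambda>_mono) auto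
    then show "\<alpha> * real (B (T i)) - 1 \<le> real (u (Suc i)) - real (u i)"
      using u[of i] u[of "Suc i"] unfolding T_Suc_real by (auto simp: algebra_simps)
    have "\<Lambda> (real (T (Suc i))) \<le> \<Lambda> (real (T i)) + log 2 (1 + real (B (T i)))"
      unfolding T_Suc_real by (intro \<Lambda>_add) auto
    then show "real (u (Suc i)) - real (u i) \<le> real (B (T i))"
      using u[of i] u[of "Suc i"] B0_log[OF B_ge, of "T i"] unfolding T_Suc_real by (auto simp: algebra_simps)
  qed
  define \<rho> where "\<rho> i = r (Suc i) - r i" for i
  define \<upsilon> where "\<upsilon> i = u (Suc i) - u i" for i
  have r_mono: "r i + 3 \<le> r (Suc i)" for i using r_diff(1)[of i] by linarith
  have \<beta>\<alpha>: "\<beta> / 2 * real (B t) + 2 \<le> \<alpha> * real (B t)" for t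
  proof -
    have "\<beta> * real (B t) \<le> \<alpha> * real (B t)" using ab by (intro mult_right_mono) auto
    then show ?thesis using B0_\<beta>[OF B_ge, of t] by (simp add: algebra_simps)
  qed
  have u_mono: "u i \<le> u (Suc i)" for i
    using u_diff(1)[of i] \<beta>\<alpha>[of "T i"] B0_\<beta>[OF B_ge, of "T i"] by linarith
  have \<rho>\<upsilon>: "\<rho> i \<le> \<upsilon> i" for i
  proof -
    have "real (r (Suc i)) - real (r i) \<le> real (u (Suc i)) - real (u i)"
      using r_diff(2)[of i] u_diff(1)[of i] \<beta>\<alpha>[of "T i"] by linarith
    then show ?thesis using r_mono[of i] u_mono[of i] by (simp add: \<rho>_def \<upsilon>_def) 
  qed
  interpret digit_blocks T \<rho> \<upsilon>
  proof
    show "T 0 = 0" by (rule T_0)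
    show "3 \<le> \<rho> i" for i using r_mono[of i] by (simp add: \<rho>_def)
    show "\<rho> i \<le> \<upsilon> i" for i by (rule \<rho>\<upsilon>)
    show "T i + \<upsilon> i \<le> T (Suc i)" for i
      using u_diff(2)[of i] u_mono[of i] by (simp add: \<upsilon>_def T_Suc)
  qed
  have u_Suc: "u i + \<upsilon> i = u (Suc i)" and r_Suc: "r i + \<rho> i = r (Suc i)" for i
    using u_mono[of i] r_mono[of i] by (simp_all add: \<upsilon>_def \<rho>_def)
  have cnt_S_T: "cnt S (T i) = u i" for i
  proof (induction i)
    case 0
    show ?case by (simp add: T_0 u_def \<Lambda>_def)
  next
    case (Suc i)
    then show ?case using cnt_Tail_Suc[of "\<lambda>_. 0" i] u_Suc[of i] unfolding S_def by simp
  qed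
  have cnt_A_T: "cnt A (T i) + r i = u i" for i
  proof (induction i)
    case 0
    show ?case by (simp add: T_0 u_def r_def \<Lambda>_def)
  next
    case (Suc i)
    then show ?case using cnt_Tail_Suc[of \<rho> i] u_Suc[of i] r_Suc[of i] \<rho>\<upsilon>[of i] unfolding A_def by simp
  qed
  have cnt_S: "cnt S (T i + d) = u i + min d (\<upsilon> i)" if "d \<le> B (T i)" for i d
    using cnt_Tail[of "\<lambda>_. 0" i d] that cnt_S_T[of i] by (simp add: S_def T_Suc)
  have cnt_A: "cnt A (T i + d) + r i + min d (\<rho> i) = cnt S (T i + d)" if "d \<le> B (T i)" for i d
    using cnt_Tail[of \<rho> i d] that cnt_A_T[of i] cnt_S[OF that] \<rho>\<upsilon>[of i] by (simp add: A_def T_Suc)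
  have block: "\<exists>i d. n = T i + d \<and> d \<le> B (T i)" for n
    using block_exists[of n] by (fastforce simp: T_Suc)
  have lower: "\<alpha> * real n + \<Lambda> (real n) \<le> K + real (cnt S n)" for n
  proof -
    obtain i d where id: "n = T i + d" "d \<le> B (T i)" using block by blast
    show ?thesis
    \<comment> \<open>While the block still fills \<open>S\<close>, the count grows with slope 1,
      which beats slope \<alpha> plus the growth of \<Lambda> up to the constant \<open>K\<close>.
      Afterwards it already equals the target at the end of the block.\<close>
    proof (cases "d \<le> \<upsilon> i")
      case True
      have "\<Lambda> (real n) \<le> \<Lambda> (real (T i)) + log 2 (1 + real d)"
        using \<Lambda>_add[of "real (T i)" "real d"] by (simp add: id)
      also have "log 2 (1 + real d) \<le> (1 - \<alpha>) / 2 * real d + K" by (rule K) simp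
      also have "(1 - \<alpha>) / 2 * real d \<le> (1 - \<alpha>) * real d" using ab by (intro mult_right_mono) auto
      finally have "\<Lambda> (real n) \<le> \<Lambda> (real (T i)) + ((1 - \<alpha>) * real d + K)" by simp
      then show ?thesis using u(1)[of i] True cnt_S[OF id(2)] by (simp add: id algebra_simps)
    next
      case False
      then have "real (cnt S n) = real (u (Suc i))" using cnt_S[OF id(2)] u_Suc[of i] by (simp add: id min_def)
      moreover have "real n \<le> real (T (Suc i))" using id by (simp add: T_Suc)
      then have "\<alpha> * real n \<le> \<alpha> * real (T (Suc i))" "\<Lambda> (real n) \<le> \<Lambda> (real (T (Suc i)))"
        using ab by (auto intro!: mult_left_mono \<Lambda>_mono)
      ultimately show ?thesis using u(1)[of "Suc i"] K(1) by linarith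
    qed
  qed
  have upper: "real (cnt S n) \<le> \<alpha> * real n + \<Lambda> (real n) + real (B (T i))"
    if "n = T i + d" "d \<le> B (T i)" for n i d
  proof -
    have "real (cnt S n) \<le> real (u (Suc i))" using cnt_S[OF that(2)] u_Suc[of i] that by simp
    also have "\<dots> \<le> \<alpha> * real (T (Suc i)) + \<Lambda> (real (T (Suc i))) + 1" by (rule u)
    also have "\<dots> \<le> \<alpha> * real (T i) + \<alpha> * real (B (T i)) + (\<Lambda> (real (T i)) + log 2 (1 + real (B (T i)))) + 1"
      unfolding T_Suc_real using \<Lambda>_add[of "real (T i)" "real (B (T i))"] by (simp add: algebra_simps)
    also have "\<dots> \<le> \<alpha> * real (T i) + \<Lambda> (real (T i)) + real (B (T i))"
      using B0_log[OF B_ge, of "T i"] by linarith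
    also have "\<dots> \<le> \<alpha> * real n + \<Lambda> (real n) + real (B (T i))"
      using that ab by (intro add_mono mult_left_mono \<Lambda>_mono) auto
    finally show ?thesis .
  qed
  have diff: "\<beta> / 2 * real n \<le> real (cnt S n) - real (cnt A n)" for n
  proof -
    obtain i d where id: "n = T i + d" "d \<le> B (T i)" using block by blast
    have eq: "real (cnt S n) - real (cnt A n) = real (r i + min d (\<rho> i))"
      using cnt_A[OF id(2)] unfolding id by linarith
    show ?thesis
    proof (cases "d \<le> \<rho> i")
      case True
      have "\<beta> / 2 * real d \<le> 1 * real d" using ab by (intro mult_right_mono) auto
      then show ?thesis using r(1)[of i] True unfolding eq by (simp add: id algebra_simps)
    next
      case False
      have "\<beta> / 2 * real n \<le> \<beta> / 2 * real (T (Suc i))"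
        using id ab by (intro mult_left_mono) (auto simp: T_Suc)
      then show ?thesis using r(1)[of "Suc i"] False r_Suc[of i] unfolding eq by (simp add: min_def)
    qed
  qed
  \<comment> \<open>As \<phi> tends to infinity, all but finitely many blocks have length at least
    \<open>m\<close>, about 1 / \<epsilon>.\<close>
  have sublinear: "\<exists>K. \<forall>l. real l \<le> K + \<epsilon> * real (T l)" if \<epsilon>: "\<epsilon> > 0" for \<epsilon>
  proof -
    define m where "m = nat \<lceil>1 / \<epsilon>\<rceil>"
    have m: "1 \<le> \<epsilon> * real m"
    proof -
      have "1 / \<epsilon> \<le> real m" unfolding m_def by linarith
      then show ?thesis using \<epsilon> by (simp add: field_simps)
    qed
    have "eventually (\<lambda>t. \<phi> t \<ge> 2 ^ m) at_top" using \<phi>_lim by (simp add: filterlim_at_top)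
    then obtain t0 where t0: "\<And>t. t \<ge> t0 \<Longrightarrow> \<phi> t \<ge> 2 ^ m" by (auto simp: eventually_at_top_linorder)
    obtain j where j: "4 * t0 < 2 ^ j" using real_arch_pow[of 2 "4 * t0"] by auto
    have large: "m \<le> B t" if "t \<ge> max 3 j" for t
    proof -
      have "(2::real) ^ j \<le> 2 ^ t" using that by (intro power_increasing) auto
      then have "\<phi> (2 ^ t / 4) \<ge> 2 ^ m" using j by (intro t0) linarith
      then have "real m \<le> log 2 (\<phi> (2 ^ t / 4))"
        by (intro le_log_of_power) auto
      then have "m \<le> nat \<lfloor>log 2 (\<phi> (2 ^ t / 4))\<rfloor>" by linarith
      then show ?thesis using that by (simp add: B_def)
    qed
    have "l * m \<le> max 3 j * m + T l" for l
    proof (induction l)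
      case (Suc l)
      show ?case
      proof (cases "max 3 j \<le> l")
        case True
        then have "max 3 j \<le> T l" using T_ge[of l] by linarith
        then have "m \<le> B (T l)" by (rule large)
        then show ?thesis using Suc by (simp add: T_Suc)
      next
        case False
        then have "Suc l * m \<le> max 3 j * m" by (intro mult_right_mono) auto
        then show ?thesis by linarith
      qed
    qed simp
    then have *: "real l * real m \<le> real (max 3 j) * real m + real (T l)" for l
      by (metis of_nat_add of_nat_le_iff of_nat_mult)
    have "real l \<le> \<epsilon> * (real (max 3 j) * real m) + \<epsilon> * real (T l)" for l
    proof -
      have "real l * 1 \<le> real l * (\<epsilon> * real m)" using m by (intro mult_left_mono) auto
      also have "\<dots> = \<epsilon> * (real l * real m)" by simp
      also have "\<dots> \<le> \<epsilon> * (real (max 3 j) * real m + real (T l))"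
        using * \<epsilon> by (intro mult_left_mono) auto
      finally show ?thesis by (simp add: distrib_left)
    qed
    then show ?thesis by blast
  qed
  \<comment> \<open>\<phi> may be less than 1; the summand \<open>1 / \<phi> 2\<close> turns
    \<open>max 1 (\<phi> t)\<close> into a multiple of \<open>\<phi> t\<close>, by
    monotonicity.\<close>
  define C where "C = 2 powr K + 2 ^ B0 * (1 + 1 / \<phi> 2)"
  have \<phi>2: "\<phi> 2 > 0" by (rule \<phi>_pos) simp
  have C: "2 powr K \<le> C" "2 ^ B0 * (1 + 1 / \<phi> 2) \<le> C" "C > 0"
    using \<phi>2 by (auto simp: C_def intro!: add_pos_pos mult_pos_pos)
  have pow: "(2 ^ n) powr \<alpha> * (real n + 1) ^ \<gamma> = 2 powr (\<alpha> * real n + \<Lambda> (real n))" for n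
    by (simp add: powr_add \<Lambda>_powr powr_powr mult.commute flip: powr_realpow)
  have 1: "(2 ^ n) powr \<alpha> * (real n + 1) ^ \<gamma> \<le> C * 2 ^ cnt S n" for n
  proof -
    have "(2 ^ n) powr \<alpha> * (real n + 1) ^ \<gamma> \<le> 2 powr (K + real (cnt S n))"
      unfolding pow using lower by (intro powr_mono) auto
    also have "\<dots> = 2 powr K * 2 ^ cnt S n" by (simp add: powr_add powr_realpow)
    also have "\<dots> \<le> C * 2 ^ cnt S n" using C by (intro mult_right_mono) auto
    finally show ?thesis .
  qed
  have 2: "2 ^ cnt S n \<le> C * ((2 ^ n) powr \<alpha> * (real n + 1) ^ \<gamma> * \<phi> (2 ^ n / 4))" if n: "n \<ge> 3" for n
  proof -
    obtain i d where id: "n = T i + d" "d \<le> B (T i)" using block by blast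
    have n8: "(2::real) ^ 3 \<le> 2 ^ n" using n by (intro power_increasing) auto
    then have \<phi>n: "\<phi> 2 \<le> \<phi> (2 ^ n / 4)"
      by (intro mono_onD[OF \<phi>_mono]) auto
    have "2 ^ B (T i) \<le> 2 ^ B0 * max 1 (\<phi> (2 ^ n / 4))"
    proof (cases "T i \<ge> 3")
      case True
      have t8: "(2::real) ^ 3 \<le> 2 ^ T i" using True by (intro power_increasing) auto
      have "(2::real) ^ T i \<le> 2 ^ n" using id by (intro power_increasing) auto
      then have "\<phi> (2 ^ T i / 4) \<le> \<phi> (2 ^ n / 4)"
        using t8 n8 by (intro mono_onD[OF \<phi>_mono]) auto
      moreover have "2 ^ nat \<lfloor>log 2 (\<phi> (2 ^ T i / 4))\<rfloor> \<le> max 1 (\<phi> (2 ^ T i / 4))"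
        using t8 by (intro power_floor_log2_le \<phi>_pos) auto
      ultimately have "2 ^ nat \<lfloor>log 2 (\<phi> (2 ^ T i / 4))\<rfloor> \<le> max 1 (\<phi> (2 ^ n / 4))" by linarith
      then show ?thesis using True by (simp add: B_def power_add)
    qed (simp add: B_def)
    also have "\<dots> \<le> 2 ^ B0 * ((1 + 1 / \<phi> 2) * \<phi> (2 ^ n / 4))"
    proof -
      have "1 \<le> 1 / \<phi> 2 * \<phi> (2 ^ n / 4)" using \<phi>2 \<phi>n by simp
      then have "max 1 (\<phi> (2 ^ n / 4)) \<le> (1 + 1 / \<phi> 2) * \<phi> (2 ^ n / 4)"
        using \<phi>2 \<phi>n unfolding distrib_right by linarith
      then show ?thesis by (intro mult_left_mono) auto
    qed
    also have "\<dots> = (2 ^ B0 * (1 + 1 / \<phi> 2)) * \<phi> (2 ^ n / 4)" by simp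
    also have "\<dots> \<le> C * \<phi> (2 ^ n / 4)"
      using C \<phi>2 \<phi>n by (intro mult_right_mono) auto
    finally have B: "2 ^ B (T i) \<le> C * \<phi> (2 ^ n / 4)" .
    have "(2::real) ^ cnt S n = 2 powr real (cnt S n)" by (simp add: powr_realpow)
    also have "\<dots> \<le> 2 powr (\<alpha> * real n + \<Lambda> (real n) + real (B (T i)))"
      using upper[OF id] by (intro powr_mono) auto
    also have "\<dots> = (2 ^ n) powr \<alpha> * (real n + 1) ^ \<gamma> * 2 ^ B (T i)"
      unfolding pow by (simp add: powr_add powr_realpow)
    also have "\<dots> \<le> (2 ^ n) powr \<alpha> * (real n + 1) ^ \<gamma> * (C * \<phi> (2 ^ n / 4))"
      using B by (intro mult_left_mono) auto
    finally show ?thesis by (simp add: mult_ac)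
  qed
  have 3: "real (cnt S (T l)) \<le> \<alpha> * real (T l) + log 2 (1 + real (T l)) + 1" for l
  proof -
    have "real \<gamma> * log 2 (1 + real (T l)) \<le> 1 * log 2 (1 + real (T l))"
      using \<gamma> by (intro mult_right_mono) auto
    then show ?thesis using u(2)[of l] by (simp add: cnt_S_T \<Lambda>_def)
  qed
  have 4: "real (cnt S (T l)) - real (cnt A (T l)) \<le> \<beta> / 2 * real (T l) + 1" for l
    using r(2)[of l] cnt_A_T[of l] cnt_S_T[of l] by linarith
  show ?thesis
    by (rule that[OF digit_blocks_axioms C(3) 1 2 diff 3 4 sublinear])
qed

section \<open>Large Fourier transforms of the planted part\<close>

text \<open>Here, unlike in \<open>planted\<close>, position \<open>k\<close> is the digit of weight \<open>2 ^ k\<close>.\<close>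
primrec words :: "nat set \<Rightarrow> nat \<Rightarrow> nat set" where
  "words F 0 = {0}"
| "words F (Suc n) = words F n \<union> (if n \<in> F then (\<lambda>w. w + 2 ^ n) ` words F n else {})"

lemma words_less: "w \<in> words F n \<Longrightarrow> w < 2 ^ n"
  by (induction n arbitrary: w) (fastforce split: if_splits)+

lemma finite_words [simp]: "finite (words F n)"
  by (induction n) auto

lemma card_words: "card (words F n) = 2 ^ cnt F n"
proof (induction n)
  case (Suc n)
  have "words F n \<inter> (\<lambda>w. w + 2 ^ n) ` words F n = {}" using words_less by fastforce
  moreover have "card ((\<lambda>w. w + 2 ^ n) ` words F n) = card (words F n)" by (rule card_image) simp
  ultimately show ?case using Suc by (simp add: card_Un_disjoint)
qed simp

lemma words_mono: "n \<le> m \<Longrightarrow> words F n \<subseteq> words F m"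
  by (induction m rule: dec_induct) auto

lemma words_mod: "w \<in> words F m \<Longrightarrow> n \<le> m \<Longrightarrow> w mod 2 ^ n \<in> words F n"
proof (induction m arbitrary: w)
  case (Suc m)
  show ?case
  proof (cases "n = Suc m")
    case True
    then show ?thesis using words_less[OF Suc.prems(1)] Suc.prems(1) by simp
  next
    case False
    then have nm: "n \<le> m" using Suc.prems by simp
    then have "(w' + 2 ^ m) mod 2 ^ n = w' mod 2 ^ n" for w' :: nat
      by (metis le_imp_power_dvd mod_add_right_eq dvd_imp_mod_0 add.right_neutral)
    then show ?thesis using Suc nm by (auto split: if_splits)
  qed
qed simp

lemma words_gap: "p \<le> n \<Longrightarrow> (\<And>k. p \<le> k \<Longrightarrow> k < n \<Longrightarrow> k \<notin> F) \<Longrightarrow> words F n = words F p"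
  by (induction n rule: dec_induct) auto

lemma cnt_Compl: "cnt (- F) n + cnt F n = n"
  by (induction n) auto

lemma emeasure_unit_intervals:
  "finite W \<Longrightarrow> emeasure lborel (\<Union>w\<in>W. {real w..<real w + 1}) = of_nat (card W)"
proof -
  assume W: "finite W"
  have "disjoint_family_on (\<lambda>w. {real w..<real w + 1}) W"
    by (auto simp: disjoint_family_on_def)
  then have "emeasure lborel (\<Union>w\<in>W. {real w..<real w + 1}) = (\<Sum>w\<in>W. emeasure lborel {real w..<real w + 1})"
    using W by (intro sum_emeasure[symmetric]) auto
  then show ?thesis by simp
qed

context digit_blocks
begin

text \<open>
  If the digits of \<open>\<xi>\<close> vanish on a run of \<open>A\<close> and on three more positions below it, then \<open>\<xi> / 2 ^ Suc k\<close>
  is within \<open>2 ^ (- j - 4)\<close> of an integer for the \<open>j\<close>-th position \<open>k\<close> of that run, so the run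
  costs only a bounded factor in the product \<open>sum_echar_planted\<close>.
\<close>
definition Free :: "nat set" where "Free = - Tail (\<lambda>i. \<rho> i - 3)"

lemma cnt_Free: "cnt Free (T l) + cnt A (T l) + 3 * l = T l"
proof -
  have "cnt (Tail (\<lambda>i. \<rho> i - 3)) (T l) = cnt A (T l) + 3 * l"
  proof (induction l)
    case (Suc l)
    have "cnt (Tail (\<lambda>i. \<rho> i - 3)) (T (Suc l)) = cnt (Tail (\<lambda>i. \<rho> i - 3)) (T l) + (\<upsilon> l - (\<rho> l - 3))"
      using \<rho>_le[of l] by (intro cnt_Tail_Suc) auto
    moreover have "cnt A (T (Suc l)) = cnt A (T l) + (\<upsilon> l - \<rho> l)"
      unfolding A_def using \<rho>_le[of l] by (rule cnt_Tail_Suc)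
    ultimately show ?case using Suc \<rho>_le[of l] \<rho>_ge[of l] by simp
  qed (simp add: T_0)
  then show ?thesis using cnt_Compl[of "Tail (\<lambda>i. \<rho> i - 3)" "T l"] by (simp add: Free_def)
qed

lemma factor_ge:
  assumes w: "w \<in> words Free m" and \<xi>: "real w \<le> \<xi>" "\<xi> < real w + 1" and j: "\<rho> i + j < \<upsilon> i"
  shows "1 - 1 / 2 ^ (j + 2) \<le> norm (1 + echar (\<xi> / 2 ^ Suc (T i + \<rho> i + j))) / 2"
proof -
  define k where "k = T i + \<rho> i + j"
  define p where "p = T i + \<rho> i - 3"
  have kp: "Suc k = p + (j + 4)" using \<rho>_ge[of i] by (simp add: k_def p_def)
  define v where "v = w mod 2 ^ Suc k"
  \<comment> \<open>A word with fewer than \<open>Suc k\<close> digits is padded with zeros, so that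
    reduction modulo \<open>2 ^ Suc k\<close> applies in either case.\<close>
  have "w \<in> words Free (max m (Suc k))" using w words_mono[of m "max m (Suc k)" Free] by auto
  then have "v \<in> words Free (Suc k)" unfolding v_def by (intro words_mod) auto
  moreover have "words Free (Suc k) = words Free p"
  proof (rule words_gap)
    fix k' assume k': "p \<le> k'" "k' < Suc k"
    then have "k' \<in> Tail (\<lambda>i. \<rho> i - 3)"
      unfolding Tail_def using j \<rho>_ge[of i] by (intro CollectI exI[of _ i]) (auto simp: p_def k_def)
    then show "k' \<notin> Free" by (simp add: Free_def)
  qed (use kp in simp)
  ultimately have "v < 2 ^ p" using words_less by blast
  then have "v + 1 \<le> 2 ^ p" by simp
  then have vp: "real v + 1 \<le> 2 ^ p" by (simp only: of_nat_le_iff[where ?'a = real, symmetric] of_nat_add of_nat_power of_nat_numeral of_nat_1)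
  define t where "t = (real v + (\<xi> - real w)) / 2 ^ Suc k"
  have "real w = real (w div 2 ^ Suc k) * 2 ^ Suc k + real v"
  proof -
    have "real w = real (w div 2 ^ Suc k * 2 ^ Suc k + v)"
      unfolding v_def by (simp only: div_mult_mod_eq)
    then show ?thesis by (simp only: of_nat_add of_nat_mult of_nat_power of_nat_numeral)
  qed
  then have "\<xi> / 2 ^ Suc k = real (w div 2 ^ Suc k) + t"
    unfolding t_def by (simp add: field_simps)
  then have eq: "echar (\<xi> / 2 ^ Suc k) = echar t" by (simp only: echar_add echar_of_nat mult_1)
  have t: "0 \<le> t" "t \<le> 1 / 2 ^ (j + 4)"
  proof -
    show "0 \<le> t" using \<xi> by (simp add: t_def)
    have "t \<le> 2 ^ p / 2 ^ Suc k" unfolding t_def using \<xi> vp by (intro divide_right_mono) auto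
    also have "\<dots> = 1 / 2 ^ (j + 4)" unfolding kp power_add by simp
    finally show "t \<le> 1 / 2 ^ (j + 4)" .
  qed
  have "norm (echar t - 1) \<le> 2 * pi * t" using norm_echar_minus_1[of t] t by simp
  also have "\<dots> \<le> 8 * (1 / 2 ^ (j + 4))" using t pi_less_4 by (intro mult_mono) auto
  finally have "norm (echar t - 1) \<le> 2 / 2 ^ (j + 2)" by (simp add: power_add)
  \<comment> \<open>Writing 2 as the difference of \<open>1 + echar t\<close> and
    \<open>echar t - 1\<close> bounds the defect of the halved factor by half the distance of
    \<open>echar t\<close> from 1.\<close>
  moreover have "2 \<le> norm (1 + echar t) + norm (echar t - 1)"
    using norm_triangle_ineq4[of "1 + echar t" "echar t - 1"] by simp
  ultimately show ?thesis unfolding k_def[symmetric] eq by simp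
qed

text \<open>Along a run of \<open>A\<close> the normalised factors are at least 1 - 1/4, 1 - 1/8,
  and so on, so their product is at least 1/2 however long the run is. Hence only the number
  \<open>l\<close> of runs enters.\<close>

lemma prod_ge:
  assumes w: "w \<in> words Free m" and \<xi>: "real w \<le> \<xi>" "\<xi> < real w + 1"
  shows "2 ^ cnt A (T l) / 2 ^ l \<le> norm (\<Prod>k\<in>{k. k < T l \<and> k \<in> A}. 1 + echar (\<xi> / 2 ^ Suc k))"
proof -
  define Q where "Q n = (\<Prod>k\<in>{k. k < n \<and> k \<in> A}. norm (1 + echar (\<xi> / 2 ^ Suc k)) / 2)" for n
  have Q_nonneg: "Q n \<ge> 0" for n unfolding Q_def by (intro prod_nonneg) auto
  have Q_Suc: "Q (Suc n) = Q n * (if n \<in> A then norm (1 + echar (\<xi> / 2 ^ Suc n)) / 2 else 1)" for n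
  proof -
    have "{k. k < Suc n \<and> k \<in> A} = (if n \<in> A then insert n {k. k < n \<and> k \<in> A} else {k. k < n \<and> k \<in> A})"
      by (auto simp: less_Suc_eq)
    then show ?thesis by (simp add: Q_def)
  qed
  \<comment> \<open>The invariant starts at 1 and never drops below 1/2. With x =
    \<open>1 / 2 ^ (j + 2)\<close> it survives a factor because (1/2 + 2x)(1 - x) \<ge> 1/2 + x for
    0 \<le> x \<le> 1/4.\<close>
  have inner: "Q (T i) * (1 / 2 + 1 / 2 ^ (min d (\<upsilon> i) - \<rho> i + 1)) \<le> Q (T i + d)"
    if "d \<le> T (Suc i) - T i" for i d
    using that
  proof (induction d)
    case (Suc d)
    then have d: "d < T (Suc i) - T i" by simp
    show ?case
    proof (cases "\<rho> i \<le> d \<and> d < \<upsilon> i")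
      case True
      define j where "j = d - \<rho> i"
      have dj: "d = \<rho> i + j" "\<rho> i + j < \<upsilon> i" using True by (auto simp: j_def)
      have "(1 / 2 + 1 / 2 ^ (j + 2)) \<le> (1 / 2 + 1 / 2 ^ (j + 1)) * (1 - 1 / 2 ^ (j + 2) :: real)"
      proof -
        define x :: real where "x = 1 / 2 ^ (j + 2)"
        have x: "0 \<le> x" "x \<le> 1 / 4" by (auto simp: x_def divide_simps)
        have "0 \<le> x * (1 / 2 - 2 * x)" using x by (intro mult_nonneg_nonneg) auto
        also have "\<dots> = (1 / 2 + 2 * x) * (1 - x) - (1 / 2 + x)" by (simp add: field_simps)
        also have "2 * x = 1 / 2 ^ (j + 1)" by (simp add: x_def)
        finally show ?thesis unfolding x_def by simp
      qed
      then have "Q (T i) * (1 / 2 + 1 / 2 ^ (j + 2)) \<le> Q (T i) * (1 / 2 + 1 / 2 ^ (j + 1)) * (1 - 1 / 2 ^ (j + 2))"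
        unfolding mult.assoc by (intro mult_left_mono Q_nonneg)
      also have "\<dots> \<le> Q (T i + d) * (norm (1 + echar (\<xi> / 2 ^ Suc (T i + d))) / 2)"
      proof (rule mult_mono)
        show "Q (T i) * (1 / 2 + 1 / 2 ^ (j + 1)) \<le> Q (T i + d)"
          using Suc dj by (simp add: min_def)
        show "1 - 1 / 2 ^ (j + 2) \<le> norm (1 + echar (\<xi> / 2 ^ Suc (T i + d))) / 2"
          using factor_ge[OF w \<xi> dj(2)] by (simp add: dj(1) add.assoc)
        show "0 \<le> 1 - 1 / (2::real) ^ (j + 2)"
          using one_le_power[of "2::real" "j + 2"] by (simp del: power_add_numeral2)
      qed (use Q_nonneg in auto)
      also have "\<dots> = Q (T i + Suc d)" using True by (simp add: Q_Suc A_def mem_Tail[OF d])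
      finally show ?thesis using True by (simp add: j_def min_def Suc_diff_le)
    next
      case False
      then have "T i + d \<notin> A" unfolding A_def by (simp add: mem_Tail[OF d])
      then have "Q (T i + Suc d) = Q (T i + d)" by (simp add: Q_Suc)
      moreover have "min (Suc d) (\<upsilon> i) - \<rho> i = min d (\<upsilon> i) - \<rho> i" using False by auto
      ultimately show ?thesis using Suc by simp
    qed
  qed simp
  have "1 / 2 ^ l \<le> Q (T l)"
  proof (induction l)
    case 0
    show ?case by (simp add: T_0 Q_def)
  next
    case (Suc l)
    have "1 / 2 ^ Suc l \<le> Q (T l) * (1 / 2)" using Suc by simp
    also have "\<dots> \<le> Q (T l) * (1 / 2 + 1 / 2 ^ (min (T (Suc l) - T l) (\<upsilon> l) - \<rho> l + 1))"
      by (intro mult_left_mono Q_nonneg) auto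
    also have "\<dots> \<le> Q (T (Suc l))" using inner[of "T (Suc l) - T l" l] T_less_Suc[of l] by simp
    finally show ?case .
  qed
  moreover have "card {k. k < n \<and> k \<in> A} = cnt A n" for n
  proof (induction n)
    case (Suc n)
    have "{k. k < Suc n \<and> k \<in> A} = (if n \<in> A then insert n {k. k < n \<and> k \<in> A} else {k. k < n \<and> k \<in> A})"
      by (auto simp: less_Suc_eq)
    then show ?case using Suc by simp
  qed simp
  then have "Q (T l) = norm (\<Prod>k\<in>{k. k < T l \<and> k \<in> A}. 1 + echar (\<xi> / 2 ^ Suc k)) / 2 ^ cnt A (T l)"
    by (simp add: Q_def prod_dividef prod_norm)
  ultimately show ?thesis by (simp add: field_simps)
qed

end

section \<open>The planted part inside the tree, and the transform of the limit measure\<close>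

context salem_tree
begin

text \<open>A planted node can branch only at positions of \<open>A\<close>, where both children
  survive because \<open>A \<subseteq> S\<close>. Outside \<open>S\<close> its single surviving
  child is the one with digit 0, by \<open>d_planted\<close>.\<close>

lemma planted_subset: "planted A n \<subseteq> e n ` {..<2 ^ cnt S n}"
proof (induction n)
  case 0
  show ?case by (simp add: e_0)
next
  case (Suc n)
  show ?case
  proof
    fix v assume "v \<in> planted A (Suc n)"
    then obtain w where w: "w \<in> planted A n" and v: "v = 2 * w \<or> (n \<in> A \<and> v = 2 * w + 1)"
      by (auto split: if_splits)
    obtain j where j: "j < 2 ^ cnt S n" "w = e n j" using Suc w by auto
    show "v \<in> e (Suc n) ` {..<2 ^ cnt S (Suc n)}"
    proof (cases "n \<in> S")
      case True
      then have "e (Suc n) (2 * j) = 2 * w" "e (Suc n) (2 * j + 1) = 2 * w + 1"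
        using j by (simp_all add: e_keep)
      moreover have "2 * j < 2 ^ cnt S (Suc n)" "2 * j + 1 < 2 ^ cnt S (Suc n)" using j True by auto
      ultimately show ?thesis using v by (metis image_eqI lessThan_iff)
    next
      case False
      then have "n \<notin> A" using A_subset by auto
      then have "v = 2 * w" using v by auto
      also have "\<dots> = e (Suc n) j" using False j w d_planted[of n j] by (simp add: e_choose)
      finally show ?thesis using j False by auto
    qed
  qed
qed

lemma planted_bij: "bij_betw (e n) {j. j < 2 ^ cnt S n \<and> e n j \<in> planted A n} (planted A n)"
  using planted_subset[of n] inj_on_e[of n] by (auto simp: bij_betw_def inj_on_def image_iff subset_iff)

lemma card_planted_idx: "card {j. j < 2 ^ cnt S n \<and> e n j \<in> planted A n} = 2 ^ cnt A n"
  using bij_betw_same_card[OF planted_bij] by (simp add: card_planted)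

definition planted_cells :: "nat \<Rightarrow> real set" where
  "planted_cells n = (\<Union>v\<in>planted A n. cell n v)"

lemma finite_union_of_intervals_planted_cells: "finite_union_of_intervals (planted_cells n)"
  unfolding finite_union_of_intervals_def planted_cells_def
  by (intro exI[of _ "cell n ` planted A n"]) (auto simp: cell_def is_interval_cc)

lemma planted_cells_borel [measurable]: "planted_cells n \<in> sets borel"
  unfolding planted_cells_def cell_def by (intro sets.finite_UN) auto

lemma AE_X_planted_cells:
  assumes "\<And>K. \<exists>n. cnt S n \<ge> K"
  shows "AE t in unit_lborel. X t \<in> planted_cells n \<longleftrightarrow> e n (idx n t) \<in> planted A n"
  using AE_X_cell[OF assms, of n] by eventually_elim (auto simp: planted_cells_def)

lemma measure_planted_cells:
  assumes "\<And>K. \<exists>n. cnt S n \<ge> K"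
  shows "measure \<mu> (planted_cells n) = 2 ^ cnt A n / 2 ^ cnt S n"
proof -
  have "measure \<mu> (planted_cells n) = measure unit_lborel {t \<in> {0..<1}. X t \<in> planted_cells n}"
    by (rule measure_mu) simp
  also have "\<dots> = measure unit_lborel {t \<in> {0..<1}. idx n t \<in> {j. e n j \<in> planted A n}}"
  proof (rule measure_eq_AE)
    show "AE t in unit_lborel. t \<in> {t \<in> {0..<1}. X t \<in> planted_cells n} \<longleftrightarrow> t \<in> {t \<in> {0..<1}. idx n t \<in> {j. e n j \<in> planted A n}}"
      using AE_X_planted_cells[OF assms, of n] by eventually_elim auto
  qed (rule unit_set_X unit_set_idx, simp?)+
  also have "\<dots> = real (card ({..<2 ^ cnt S n} \<inter> {j. e n j \<in> planted A n})) / 2 ^ cnt S n"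
    by (rule measure_idx)
  also have "{..<2 ^ cnt S n} \<inter> {j. e n j \<in> planted A n} = {j. j < 2 ^ cnt S n \<and> e n j \<in> planted A n}"
    by auto
  finally show ?thesis by (simp add: card_planted_idx)
qed

lemma fourier_measure_mu: "fourier_measure \<mu> \<xi> = (LINT t|unit_lborel. echar (\<xi> * X t))"
proof -
  have "fourier_measure \<mu> \<xi> = (LINT x|\<mu>. echar (\<xi> * x))"
    by (simp add: fourier_measure_def echar_def cis_conv_exp mult_ac)
  also have "\<dots> = (LINT t|unit_lborel. echar (\<xi> * X t))"
    unfolding \<mu>_def by (rule integral_distr) (auto intro: measurable_unit)
  finally show ?thesis .
qed

lemma fourier_measure_planted_cells:
  assumes "\<And>K. \<exists>n. cnt S n \<ge> K"
  shows "fourier_measure (density \<mu> (\<lambda>x. ennreal (indicator (planted_cells n) x))) \<xi>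
    = (LINT t|unit_lborel. of_real (of_bool (e n (idx n t) \<in> planted A n)) * echar (\<xi> * X t))"
proof -
  have [measurable]: "planted_cells n \<in> sets \<mu>" "sets \<mu> = sets borel" by (simp_all add: sets_mu)
  have "fourier_measure (density \<mu> (\<lambda>x. ennreal (indicator (planted_cells n) x))) \<xi>
      = (LINT x|density \<mu> (\<lambda>x. ennreal (indicator (planted_cells n) x)). echar (\<xi> * x))"
    by (simp add: fourier_measure_def echar_def cis_conv_exp mult_ac)
  also have "\<dots> = (LINT x|\<mu>. indicator (planted_cells n) x *\<^sub>R echar (\<xi> * x))"
    by (rule integral_density) (auto simp: sets_mu cong: measurable_cong_sets)
  also have "\<dots> = (LINT t|unit_lborel. indicator (planted_cells n) (X t) *\<^sub>R echar (\<xi> * X t))"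
    unfolding \<mu>_def by (rule integral_distr) (auto intro: measurable_unit)
  also have "\<dots> = (LINT t|unit_lborel. of_real (of_bool (e n (idx n t) \<in> planted A n)) * echar (\<xi> * X t))"
  proof (rule integral_cong_AE)
    show "AE t in unit_lborel. indicator (planted_cells n) (X t) *\<^sub>R echar (\<xi> * X t)
        = of_real (of_bool (e n (idx n t) \<in> planted A n)) * echar (\<xi> * X t)"
      using AE_X_planted_cells[OF assms, of n] by eventually_elim (auto simp: indicator_def)
    have [measurable]: "X \<in> borel_measurable unit_lborel" "idx n \<in> unit_lborel \<rightarrow>\<^sub>M count_space UNIV"
      by (intro measurable_unit measurable_X measurable_idx)+
    show "(\<lambda>t. indicator (planted_cells n) (X t) *\<^sub>R echar (\<xi> * X t)) \<in> borel_measurable unit_lborel"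
      by measurable
    show "(\<lambda>t. of_real (of_bool (e n (idx n t) \<in> planted A n)) * echar (\<xi> * X t)) \<in> borel_measurable unit_lborel"
      by measurable
  qed
  finally show ?thesis .
qed

lemma fourier_decay:
  assumes b: "0 < b" "b < 1"
    and K: "\<And>n. 11 * sqrt ((real n + 1) / 2 ^ cnt S n) + 2 ^ cnt A n / 2 ^ cnt S n \<le> K * (2 ^ n) powr (- b)"
  shows "\<exists>C. \<forall>\<xi>. \<xi> \<noteq> 0 \<longrightarrow> norm (fourier_measure \<mu> \<xi>) \<le> C * \<bar>\<xi>\<bar> powr (- b)"
proof -
  obtain C where C: "\<And>\<xi> n. 1 \<le> \<bar>\<xi>\<bar> \<Longrightarrow> norm (avg n \<xi> * kern (\<xi> / 2 ^ n)) \<le> C * \<bar>\<xi>\<bar> powr (- b)"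
    using smoothed_avg_decay[OF b K] by blast
  have near: "norm (fourier_measure \<mu> \<xi> - avg n \<xi>) \<le> 2 * pi * \<bar>\<xi>\<bar> / 2 ^ n" for n \<xi>
    using echar_X_integral[where g = "\<lambda>_. 1" and n = n and \<xi> = \<xi>] by (simp add: fourier_measure_mu avg_def)
  have le1: "norm (fourier_measure \<mu> \<xi>) \<le> 1" for \<xi>
  proof -
    have "norm (LINT t|unit_lborel. echar (\<xi> * X t)) \<le> (LINT t|unit_lborel. norm (echar (\<xi> * X t)))"
      by (rule integral_norm_bound)
    then show ?thesis
      using prob_space.prob_space[OF prob_space_unit_lborel] by (simp add: fourier_measure_mu)
  qed
  have "norm (fourier_measure \<mu> \<xi>) \<le> max C 1 * \<bar>\<xi>\<bar> powr (- b)" if "\<xi> \<noteq> 0" for \<xi>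
  proof (cases "\<bar>\<xi>\<bar> \<ge> 1")
    case True
    \<comment> \<open>Of the error, \<open>2 * pi\<close> comes from replacing points by left
      endpoints of cells and \<open>pi\<close> from replacing 1 by \<open>kern\<close>; it vanishes
      as n grows with \<xi> fixed.\<close>
    have "norm (fourier_measure \<mu> \<xi>) \<le> C * \<bar>\<xi>\<bar> powr (- b) + 3 * pi * \<bar>\<xi>\<bar> * (1 / 2) ^ n" for n
    proof -
      have "norm (a - b + c) \<le> norm a + norm b + norm c" for a b c :: complex
        using norm_triangle_ineq[of "a - b" c] norm_triangle_ineq4[of a b] by linarith
      from this[of "fourier_measure \<mu> \<xi> - avg n \<xi>" "avg n \<xi> * (kern (\<xi> / 2 ^ n) - 1)" "avg n \<xi> * kern (\<xi> / 2 ^ n)"]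
      have "norm (fourier_measure \<mu> \<xi>) \<le> norm (fourier_measure \<mu> \<xi> - avg n \<xi>)
          + norm (avg n \<xi> * (kern (\<xi> / 2 ^ n) - 1)) + norm (avg n \<xi> * kern (\<xi> / 2 ^ n))"
        by (simp add: algebra_simps)
      moreover have "norm (avg n \<xi> * (kern (\<xi> / 2 ^ n) - 1)) \<le> 1 * (pi * \<bar>\<xi> / 2 ^ n\<bar>)"
        unfolding norm_mult using that by (intro mult_mono norm_avg_le_1 norm_kern_minus_1) auto
      moreover note C[OF True, of n] near[of \<xi> n]
      moreover have "2 * pi * \<bar>\<xi>\<bar> / 2 ^ n + 1 * (pi * \<bar>\<xi> / 2 ^ n\<bar>) = 3 * pi * \<bar>\<xi>\<bar> * (1 / 2) ^ n"
        by (simp add: power_one_over abs_divide)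
      ultimately show ?thesis by linarith
    qed
    moreover have "(\<lambda>n. C * \<bar>\<xi>\<bar> powr (- b) + 3 * pi * \<bar>\<xi>\<bar> * (1 / 2) ^ n) \<longlonglongrightarrow> C * \<bar>\<xi>\<bar> powr (- b) + 3 * pi * \<bar>\<xi>\<bar> * 0"
      by (intro tendsto_intros LIMSEQ_realpow_zero) auto
    ultimately have "norm (fourier_measure \<mu> \<xi>) \<le> C * \<bar>\<xi>\<bar> powr (- b) + 3 * pi * \<bar>\<xi>\<bar> * 0"
      by (intro LIMSEQ_le_const) auto
    also have "\<dots> \<le> max C 1 * \<bar>\<xi>\<bar> powr (- b)" by (simp add: mult_right_mono)
    finally show ?thesis .
  next
    case False
    then have "1 \<le> \<bar>\<xi>\<bar> powr (- b)"
      using powr_mono2'[of "- b" "\<bar>\<xi>\<bar>" 1] b that by simp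
    then have "1 * 1 \<le> max C 1 * \<bar>\<xi>\<bar> powr (- b)" by (intro mult_mono) auto
    then show ?thesis using le1[of \<xi>] by linarith
  qed
  then show ?thesis by blast
qed

end

section \<open>The restriction ratios\<close>

lemma Lq_norm_ge:
  assumes c: "c > 0" and q: "q > 0" and Z: "Z \<in> sets M" "emeasure M Z = ennreal m" "m \<ge> 0"
    and g: "\<And>x. x \<in> Z \<Longrightarrow> c \<le> norm (g x)"
  shows "ennreal (c * m powr (1 / q)) \<le> Lq_norm q M g"
proof -
  define J where "J = (\<integral>\<^sup>+ x. ennreal (norm (g x) powr q) \<partial>M)"
  have "ennreal (c powr q * m) = (\<integral>\<^sup>+ x. ennreal (c powr q) * indicator Z x \<partial>M)"
    using Z by (simp add: nn_integral_cmult_indicator ennreal_mult)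
  also have "\<dots> \<le> J"
    unfolding J_def using g c q by (intro nn_integral_mono) (auto simp: indicator_def intro!: ennreal_leI powr_mono2)
  finally have J: "ennreal (c powr q * m) \<le> J" .
  show ?thesis
  proof (cases "J = \<infinity>")
    case True
    then show ?thesis by (simp add: Lq_norm_def J_def)
  next
    case False
    then have "c powr q * m \<le> enn2real J"
      using J Z by (metis enn2real_ennreal enn2real_mono infinity_ennreal_def less_top mult_nonneg_nonneg powr_ge_zero)
    then have "(c powr q * m) powr (1 / q) \<le> enn2real J powr (1 / q)"
      using Z q by (intro powr_mono2) auto
    moreover have "(c powr q * m) powr (1 / q) = c * m powr (1 / q)"
      using c q Z by (simp add: powr_mult powr_powr)
    ultimately show ?thesis using False by (auto simp: Lq_norm_def J_def Let_def intro!: ennreal_leI)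
  qed
qed

lemma Lq_norm_indicator:
  assumes "finite_measure M" "B \<in> sets M" "q > 0"
  shows "Lq_norm q M (indicator B :: _ \<Rightarrow> real) = ennreal (measure M B powr (1 / q))"
proof -
  have "(\<integral>\<^sup>+ x. ennreal (norm (indicator B x :: real) powr q) \<partial>M) = (\<integral>\<^sup>+ x. indicator B x \<partial>M)"
    by (intro nn_integral_cong) (auto simp: indicator_def)
  also have "\<dots> = ennreal (measure M B)"
    using assms by (simp add: finite_measure.emeasure_eq_measure)
  finally show ?thesis by (simp add: Lq_norm_def)
qed

lemma interval_facts:
  assumes I: "is_interval I" "bounded I" "I \<noteq> ({} :: real set)"
  shows "I \<subseteq> {Inf I..Sup I}" "{Inf I<..<Sup I} \<subseteq> I" "I \<in> sets borel"
proof -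
  have bdd: "bdd_above I" "bdd_below I" using I by (auto intro: bounded_imp_bdd_above bounded_imp_bdd_below)
  show 1: "I \<subseteq> {Inf I..Sup I}" using bdd by (auto intro: cInf_lower cSup_upper)
  show 2: "{Inf I<..<Sup I} \<subseteq> I"
  proof
    fix x assume "x \<in> {Inf I<..<Sup I}"
    then obtain y z where "y \<in> I" "y < x" "z \<in> I" "x < z"
      using I(3) bdd by (auto simp: cInf_less_iff less_cSup_iff)
    then show "x \<in> I" using I(1) by (meson is_interval_1 less_imp_le)
  qed
  have "I = {Inf I<..<Sup I} \<union> (I \<inter> {Inf I, Sup I})" using 1 2 by force
  moreover have "I \<inter> {Inf I, Sup I} \<in> sets borel"
    by (intro borel_closed finite_imp_closed) auto
  ultimately show "I \<in> sets borel" by (metis borel_open open_greaterThanLessThan sets.Un)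
qed

section \<open>Growth of the ratios\<close>

context digit_blocks
begin

text \<open>The product over \<open>A\<close> gives a main term of size \<open>2 ^ (- l)\<close>
  relative to the planted mass. Words with \<open>T l - (l + 5)\<close> digits keep |\<xi>| so far
  below \<open>2 ^ T l\<close> that the discretisation error is at most half of it. For l \<ge> 3
  this digit count is not truncated at 0, since \<open>T l \<ge> 3 * l\<close>.\<close>

lemma fourier_lower_bound:
  assumes tree: "salem_tree S e d A" and unb: "\<And>K. \<exists>n. cnt S n \<ge> K"
    and l: "l \<ge> 3" and w: "w \<in> words Free (T l - (l + 5))" and \<xi>: "real w \<le> \<xi>" "\<xi> < real w + 1"
  shows "2 ^ cnt A (T l) / 2 ^ cnt S (T l) / 2 ^ l / 2
    \<le> norm (fourier_measure (density (binary_tree.\<mu> S e) (\<lambda>x. ennreal (indicator (salem_tree.planted_cells A (T l)) x))) \<xi>)"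
proof -
  interpret tr: salem_tree S e d A by (rule tree)
  define L where "L = T l"
  define M where "M = (2::real) ^ cnt S L"
  define g where "g j = (of_bool (e L j \<in> planted A L) :: real)" for j
  have sum_g: "(\<Sum>j<2 ^ cnt S L. \<bar>g j\<bar>) = 2 ^ cnt A L"
  proof -
    have "(\<Sum>j<2 ^ cnt S L. \<bar>g j\<bar>) = real (card ({..<2 ^ cnt S L} \<inter> {j. e L j \<in> planted A L}))"
      by (simp add: g_def of_bool_def sum.If_cases if_distrib)
    also have "{..<2 ^ cnt S L} \<inter> {j. e L j \<in> planted A L} = {j. j < 2 ^ cnt S L \<and> e L j \<in> planted A L}"
      by auto
    finally show ?thesis by (simp add: tr.card_planted_idx)
  qed
  have "(\<Sum>j<2 ^ cnt S L. of_real (g j) * echar (\<xi> * (real (e L j) / 2 ^ L)))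
      = (\<Sum>j\<in>{j. j < 2 ^ cnt S L \<and> e L j \<in> planted A L}. echar (\<xi> * (real (e L j) / 2 ^ L)))"
    by (rule sum.mono_neutral_cong_right) (auto simp: g_def)
  also have "\<dots> = (\<Sum>v\<in>planted A L. echar (\<xi> * (real v / 2 ^ L)))"
    by (rule sum.reindex_bij_betw[OF tr.planted_bij])
  also have "\<dots> = (\<Prod>k\<in>{k. k < L \<and> k \<in> A}. 1 + echar (\<xi> / 2 ^ Suc k))"
    by (rule sum_echar_planted)
  finally have main: "2 ^ cnt A L / 2 ^ l \<le> norm (\<Sum>j<2 ^ cnt S L. of_real (g j) * echar (\<xi> * (real (e L j) / 2 ^ L)))"
    using prod_ge[OF w \<xi>, of l] by (simp add: L_def)
  have "l + 5 \<le> L" using T_ge[of l] l by (simp add: L_def)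
  then have L: "L = (L - (l + 5)) + l + 5" by simp
  have "w + 1 \<le> 2 ^ (L - (l + 5))" using words_less[OF w] by (simp add: L_def)
  then have "real w + 1 \<le> 2 ^ (L - (l + 5))"
    by (simp only: of_nat_le_iff[where ?'a = real, symmetric] of_nat_add of_nat_power of_nat_numeral of_nat_1)
  then have \<xi>_le: "\<bar>\<xi>\<bar> \<le> 2 ^ (L - (l + 5))" using \<xi> by simp
  have "2 * pi * \<bar>\<xi>\<bar> / 2 ^ L \<le> 8 * 2 ^ (L - (l + 5)) / 2 ^ L"
    using \<xi>_le pi_less_4 by (intro divide_right_mono mult_mono) auto
  also have "\<dots> = 8 * 2 ^ (L - (l + 5)) / (2 ^ (L - (l + 5)) * 2 ^ l * 2 ^ 5)"
    using L by (metis power_add)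
  also have "\<dots> \<le> 1 / 2 ^ l / 2" by (simp add: field_simps)
  finally have err: "2 * pi * \<bar>\<xi>\<bar> / 2 ^ L * (2 ^ cnt A L / M) \<le> 1 / 2 ^ l / 2 * (2 ^ cnt A L / M)"
    by (intro mult_right_mono) (auto simp: M_def)
  define I where "I = fourier_measure (density tr.\<mu> (\<lambda>x. ennreal (indicator (tr.planted_cells L) x))) \<xi>"
  define Y where "Y = (\<Sum>j<2 ^ cnt S L. of_real (g j) * echar (\<xi> * (real (e L j) / 2 ^ L)))"
  have I: "I = (LINT t|unit_lborel. of_real (g (tr.idx L t)) * echar (\<xi> * tr.X t))"
    unfolding I_def g_def by (rule tr.fourier_measure_planted_cells[OF unb])
  have "norm (I - Y / of_real M) \<le> 2 * pi * \<bar>\<xi>\<bar> / 2 ^ L * (2 ^ cnt A L / M)"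
    using tr.echar_X_integral[of g L \<xi>] unfolding I Y_def M_def sum_g by simp
  moreover have "2 ^ cnt A L / 2 ^ l / M \<le> norm (Y / of_real M)"
  proof -
    have "norm (Y / of_real M) = norm Y / M" by (simp add: M_def norm_divide norm_power)
    then show ?thesis using divide_right_mono[OF main, of M] unfolding Y_def by (simp add: M_def)
  qed
  moreover have "norm (Y / of_real M) \<le> norm I + norm (I - Y / of_real M)"
    using norm_triangle_ineq4[of I "I - Y / of_real M"] by simp
  moreover have "2 ^ cnt A L / 2 ^ l / M = 2 * (1 / 2 ^ l / 2 * (2 ^ cnt A L / M))" by simp
  moreover have "2 ^ cnt A L / M / 2 ^ l / 2 = 1 / 2 ^ l / 2 * (2 ^ cnt A L / M)" by simp
  ultimately have "2 ^ cnt A L / M / 2 ^ l / 2 \<le> norm I" using err by linarith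
  then show ?thesis by (simp add: I_def M_def L_def)
qed

lemma norm_ratio_ge:
  assumes tree: "salem_tree S e d A" and unb: "\<And>K. \<exists>n. cnt S n \<ge> K" and l: "l \<ge> 3" and q: "q > 0"
  defines "a \<equiv> real (cnt A (T l))" and "s \<equiv> real (cnt S (T l))"
  shows "ennreal (2 powr ((a - s) / 2 - real l - 1 + (real (T l) - a - 4 * real l - 5) / q))
    \<le> Lq_norm q lborel (fourier_measure (density (binary_tree.\<mu> S e) (\<lambda>x. ennreal (indicator (salem_tree.planted_cells A (T l)) x))))
      / Lq_norm 2 (binary_tree.\<mu> S e) (indicator (salem_tree.planted_cells A (T l)) :: real \<Rightarrow> real)"
proof -
  interpret tr: salem_tree S e d A by (rule tree)
  define m where "m = T l - (l + 5)"
  define Z where "Z = (\<Union>w\<in>words Free m. {real w..<real w + 1})"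
  define c where "c = (2::real) ^ cnt A (T l) / 2 ^ cnt S (T l) / 2 ^ l / 2"
  have c: "c = 2 powr (a - s - real l - 1)"
    by (simp add: c_def a_def s_def powr_diff powr_realpow)
  have Z: "emeasure lborel Z = ennreal (2 powr real (cnt Free m))" "Z \<in> sets lborel"
    unfolding Z_def by (auto simp: emeasure_unit_intervals card_words powr_realpow ennreal_of_nat_eq_real_of_nat)
  have "ennreal (c * (2 powr real (cnt Free m)) powr (1 / q))
    \<le> Lq_norm q lborel (fourier_measure (density tr.\<mu> (\<lambda>x. ennreal (indicator (tr.planted_cells (T l)) x))))"
  proof (rule Lq_norm_ge[OF _ q Z(2) Z(1)])
    fix \<xi> assume "\<xi> \<in> Z"
    then show "c \<le> norm (fourier_measure (density tr.\<mu> (\<lambda>x. ennreal (indicator (tr.planted_cells (T l)) x))) \<xi>)"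
      using fourier_lower_bound[OF tree unb l, of _ \<xi>] by (auto simp: Z_def m_def c_def)
  qed (auto simp: c)
  moreover have "Lq_norm 2 tr.\<mu> (indicator (tr.planted_cells (T l)) :: real \<Rightarrow> real) = ennreal (2 powr ((a - s) / 2))"
  proof -
    have "finite_measure tr.\<mu>" using tr.prob_space_mu by (rule prob_space.finite_measure)
    then have "Lq_norm 2 tr.\<mu> (indicator (tr.planted_cells (T l)) :: real \<Rightarrow> real) = ennreal (measure tr.\<mu> (tr.planted_cells (T l)) powr (1 / 2))"
      by (rule Lq_norm_indicator) (auto simp: tr.sets_mu)
    also have "measure tr.\<mu> (tr.planted_cells (T l)) = 2 powr (a - s)"
      by (simp add: tr.measure_planted_cells[OF unb] a_def s_def powr_diff powr_realpow)
    finally show ?thesis by (simp add: powr_powr)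
  qed
  ultimately have "ennreal (c * (2 powr real (cnt Free m)) powr (1 / q) / 2 powr ((a - s) / 2))
    \<le> Lq_norm q lborel (fourier_measure (density tr.\<mu> (\<lambda>x. ennreal (indicator (tr.planted_cells (T l)) x))))
      / Lq_norm 2 tr.\<mu> (indicator (tr.planted_cells (T l)) :: real \<Rightarrow> real)"
    by (subst divide_ennreal[symmetric]) (auto simp: c intro!: divide_right_mono_ennreal)
  moreover have "2 powr ((a - s) / 2 - real l - 1 + (real (T l) - a - 4 * real l - 5) / q)
      \<le> c * (2 powr real (cnt Free m)) powr (1 / q) / 2 powr ((a - s) / 2)"
  proof -
    \<comment> \<open>Dropping the last \<open>l + 5\<close> positions loses at most as many free
      digits; with three reserved digits in each of \<open>l\<close> blocks the loss is at most
      \<open>4 * l + 5\<close>.\<close>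
    have step: "cnt Free (n + k) \<le> cnt Free n + k" for n k by (induction k) auto
    have "T l = m + (l + 5)" using T_ge[of l] l by (simp add: m_def)
    then have "cnt Free (T l) \<le> cnt Free m + (l + 5)" using step[of m "l + 5"] by simp
    then have "real (T l) - a - 4 * real l - 5 \<le> real (cnt Free m)"
      using cnt_Free[of l] unfolding a_def by linarith
    then have "(real (T l) - a - 4 * real l - 5) / q \<le> real (cnt Free m) / q"
      using q by (intro divide_right_mono) auto
    moreover have "c * (2 powr real (cnt Free m)) powr (1 / q) / 2 powr ((a - s) / 2)
      = 2 powr ((a - s - real l - 1) + real (cnt Free m) / q - (a - s) / 2)"
      by (simp add: c powr_powr powr_diff powr_add)
    moreover have "(a - s) / 2 = (a - s) - (a - s) / 2" by (simp add: field_simps)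
    ultimately show ?thesis by (simp only:) (intro powr_mono, linarith, simp)
  qed
  ultimately show ?thesis using ennreal_leI order_trans by blast
qed

end

lemma exponent_unbounded:
  fixes \<alpha> \<beta> q :: real and a s t :: "nat \<Rightarrow> real"
  assumes ab: "0 < \<beta>" and q: "2 \<le> q" "q < 2 + 4 * (1 - \<alpha>) / \<beta>"
    and t: "\<And>l. 3 * real l \<le> t l"
    and s: "\<And>l. s l \<le> \<alpha> * t l + log 2 (1 + t l) + 1"
    and lo: "\<And>l. s l - a l \<le> \<beta> / 2 * t l + 1" and hi: "\<And>l. \<beta> / 2 * t l \<le> s l - a l"
    and small: "\<And>\<epsilon>. \<epsilon> > 0 \<Longrightarrow> \<exists>K. \<forall>l. real l \<le> K + \<epsilon> * t l"
  shows "\<exists>l\<ge>3. B \<le> (a l - s l) / 2 - real l - 1 + (t l - a l - 4 * real l - 5) / q"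
proof -
  \<comment> \<open>The linear growth rate of the exponent: \<open>- \<beta> / 4\<close> from mass
    and L2 norm, the rest from the measure of the set of good frequencies.\<close>
  define \<kappa> where "\<kappa> = (1 - \<alpha> + \<beta> / 2) / q - \<beta> / 4"
  have "q * \<beta> < (2 + 4 * (1 - \<alpha>) / \<beta>) * \<beta>" using q ab by (intro mult_strict_right_mono) auto
  also have "\<dots> = 4 * (1 - \<alpha> + \<beta> / 2)" using ab by (simp add: distrib_right)
  finally have "q * \<beta> < 4 * (1 - \<alpha> + \<beta> / 2)" .
  then have \<kappa>: "\<kappa> > 0" using q by (simp add: \<kappa>_def field_simps)
  \<comment> \<open>Half of \<open>\<kappa> * t l\<close> absorbs the lower order terms:
    \<open>l\<close> occurs with total weight at most 3 and the logarithm with weight at most 1/2,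
    each costing a quarter of \<open>\<kappa> * t l\<close> plus a constant. The other half exceeds
    \<open>D\<close>.\<close>
  obtain K1 where K1: "\<And>l. real l \<le> K1 + \<kappa> / 12 * t l" using small[of "\<kappa> / 12"] \<kappa> by auto
  obtain K2 where K2: "\<And>d. d \<ge> 0 \<Longrightarrow> log 2 (1 + d) \<le> \<kappa> / 2 * d + K2"
    using log2_linear_bound[of "\<kappa> / 2"] \<kappa> by auto
  define D where "D = B + 3 * K1 + K2 / 2 + 5"
  obtain l0 where l0: "D * 2 / \<kappa> < real l0" using reals_Archimedean2 by blast
  define l where "l = max 3 l0"
  have tl: "0 \<le> t l" using t[of l] by linarith
  have "D * 2 / \<kappa> \<le> t l" using l0 t[of l] tl unfolding l_def by linarith
  then have D: "D \<le> \<kappa> * t l / 2" using \<kappa> by (simp add: field_simps)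
  define z where "z = log 2 (1 + t l) + 6 + 4 * real l"
  have z: "0 \<le> z" using tl by (simp add: z_def)
  have "(1 - \<alpha> + \<beta> / 2) * t l - z \<le> t l - a l - 4 * real l - 5"
    using s[of l] hi[of l] unfolding z_def by (simp add: algebra_simps)
  then have "((1 - \<alpha> + \<beta> / 2) * t l - z) / q \<le> (t l - a l - 4 * real l - 5) / q"
    using q by (intro divide_right_mono) auto
  moreover have "((1 - \<alpha> + \<beta> / 2) * t l - z) / q = (\<kappa> + \<beta> / 4) * t l - z / q"
    by (simp add: \<kappa>_def diff_divide_distrib)
  moreover have "z / q \<le> z / 2" using q z by (intro divide_left_mono) auto
  moreover have "(\<kappa> + \<beta> / 4) * t l = \<kappa> * t l + \<beta> / 2 * t l / 2" by (simp add: algebra_simps)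
  moreover define R where "R = (t l - a l - 4 * real l - 5) / q"
  moreover define y where "y = \<beta> / 2 * t l"
  ultimately have "\<kappa> * t l + y / 2 - z / 2 \<le> R" by linarith
  moreover have "s l - a l \<le> y + 1" using lo[of l] by (simp add: y_def)
  ultimately have "\<kappa> * t l - z / 2 - real l - 3 / 2 \<le> (a l - s l) / 2 - real l - 1 + R" by argo
  then have "\<kappa> * t l - z / 2 - real l - 3 / 2 \<le> (a l - s l) / 2 - real l - 1 + (t l - a l - 4 * real l - 5) / q"
    unfolding R_def .
  moreover have "B \<le> \<kappa> * t l - z / 2 - real l - 3 / 2"
    using K1[of l] K2[OF tl] D unfolding z_def D_def by argo
  ultimately show ?thesis by (intro exI[of _ l]) (auto simp: l_def)
qed

text \<open>\<gamma> is the power of the logarithm in the mass bounds: 1 yields (ii) and 0 yields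
  (ii'), the latter only with a gap between \<beta> and \<alpha>.\<close>

lemma near_extremal_measure:
  fixes \<alpha> \<beta> :: real and \<phi> :: "real \<Rightarrow> real" and \<gamma> :: nat
  assumes ab: "0 < \<beta>" "\<beta> \<le> \<alpha>" "\<alpha> < 1" and \<gamma>: "\<gamma> \<le> 1" "\<gamma> = 1 \<or> \<beta> < \<alpha>"
    and \<phi>_pos: "\<And>t. t \<ge> 2 \<Longrightarrow> \<phi> t > 0" and \<phi>_mono: "mono_on {2..} \<phi>"
    and \<phi>_lim: "filterlim \<phi> at_top at_top"
  shows "\<exists>(E :: real set) (\<mu> :: real measure) (f :: nat \<Rightarrow> real \<Rightarrow> real) (c :: real) (C :: real).
        compact E \<and> prob_space \<mu> \<and> sets \<mu> = sets borel \<and> measure \<mu> E = 1 \<and>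
        (\<forall>l\<ge>1. (\<exists>S. finite_union_of_intervals S \<and> f l = indicator S) \<and> Lq_norm 2 \<mu> (f l) > 0) \<and>
        0 < c \<and> c \<le> C \<and>
        (\<forall>\<xi>. \<xi> \<noteq> 0 \<longrightarrow> norm (fourier_measure \<mu> \<xi>) \<le> C * \<bar>\<xi>\<bar> powr (- \<beta> / 2)) \<and>
        (\<forall>I. interval_centered_in I E \<and> 0 < interval_length I \<and> interval_length I < 1 / 2 \<longrightarrow>
           c * (interval_length I powr \<alpha> / (\<phi> (1 / interval_length I) * ln (1 / interval_length I) ^ \<gamma>)) \<le> measure \<mu> I \<and>
           measure \<mu> I \<le> C * (interval_length I powr \<alpha> / ln (1 / interval_length I) ^ \<gamma>)) \<and>
        (\<forall>q. 2 \<le> q \<and> q < 2 + 4 * (1 - \<alpha>) / \<beta> \<longrightarrow>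
           (SUP l\<in>{1..}. Lq_norm q lborel (fourier_measure (density \<mu> (\<lambda>x. ennreal (f l x))))
                         / Lq_norm 2 \<mu> (f l)) = \<infinity>)"
proof -
  obtain T \<rho> \<upsilon> C where "digit_blocks T \<rho> \<upsilon>" and C: "0 < C"
    and below: "\<And>n. (2 ^ n) powr \<alpha> * (real n + 1) ^ \<gamma> \<le> C * 2 ^ cnt (digit_blocks.S T \<upsilon>) n"
    and above: "\<And>n. n \<ge> 3 \<Longrightarrow> 2 ^ cnt (digit_blocks.S T \<upsilon>) n \<le> C * ((2 ^ n) powr \<alpha> * (real n + 1) ^ \<gamma> * \<phi> (2 ^ n / 4))"
    and gap: "\<And>n. \<beta> / 2 * real n \<le> real (cnt (digit_blocks.S T \<upsilon>) n) - real (cnt (digit_blocks.A T \<rho> \<upsilon>) n)"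
    and S_T: "\<And>l. real (cnt (digit_blocks.S T \<upsilon>) (T l)) \<le> \<alpha> * real (T l) + log 2 (1 + real (T l)) + 1"
    and gap_T: "\<And>l. real (cnt (digit_blocks.S T \<upsilon>) (T l)) - real (cnt (digit_blocks.A T \<rho> \<upsilon>) (T l)) \<le> \<beta> / 2 * real (T l) + 1"
    and sublinear: "\<And>\<epsilon>. \<epsilon> > 0 \<Longrightarrow> \<exists>K. \<forall>l. real l \<le> K + \<epsilon> * real (T l)"
    using digit_blocks_exist[OF ab \<gamma>(1) \<phi>_pos \<phi>_mono \<phi>_lim] by blast
  interpret digit_blocks T \<rho> \<upsilon> by fact
  obtain e d where tree: "salem_tree S e d A" using salem_tree_exists[OF A_subset_S] by blast
  interpret tr: salem_tree S e d A by (rule tree)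
  have unb: "\<exists>n. cnt S n \<ge> K" for K
  proof (rule ccontr)
    assume "\<not> (\<exists>n. cnt S n \<ge> K)"
    then have le: "cnt S n \<le> K" for n by (meson nat_le_linear)
    obtain n where n: "C * 2 ^ K < (2 powr \<alpha>) ^ n" using real_arch_pow[of "2 powr \<alpha>" "C * 2 ^ K"] ab by auto
    have "(2 powr \<alpha>) ^ n = (2 ^ n) powr \<alpha> * 1" by (simp add: powr_powr mult.commute flip: powr_realpow)
    also have "\<dots> \<le> (2 ^ n) powr \<alpha> * (real n + 1) ^ \<gamma>" by (intro mult_left_mono one_le_power) auto
    also have "\<dots> \<le> C * 2 ^ cnt S n" by (rule below)
    also have "\<dots> \<le> C * 2 ^ K" using C le by (intro mult_left_mono power_increasing) auto
    finally show False using n by simp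
  qed
  obtain K where K: "\<And>n. (real n + 1) / 2 ^ cnt S n \<le> K * (2 ^ n) powr (- \<beta>)" "K \<ge> 0"
  proof (cases "\<gamma> = 1")
    case True
    have "(real n + 1) / 2 ^ cnt S n \<le> C * (2 ^ n) powr (- \<beta>)" for n
    proof -
      have "(2 ^ n) powr \<beta> * (real n + 1) \<le> (2 ^ n) powr \<alpha> * (real n + 1) ^ \<gamma>"
        unfolding True using ab by (auto intro!: mult_right_mono powr_mono)
      also have "\<dots> \<le> C * 2 ^ cnt S n" by (rule below)
      finally show ?thesis by (simp add: powr_minus divide_simps mult_ac)
    qed
    then show ?thesis using C by (intro that[of C]) auto
  next
    case False
    then have "\<gamma> = 0" "\<beta> < \<alpha>" using \<gamma> by auto
    \<comment> \<open>The gap \<alpha> - \<beta> absorbs the factor \<open>n + 1\<close> of the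
      discrepancy bound.\<close>
    obtain K' where K': "\<And>d. d \<ge> 0 \<Longrightarrow> log 2 (1 + d) \<le> (\<alpha> - \<beta>) * d + K'"
      using log2_linear_bound[of "\<alpha> - \<beta>"] \<open>\<beta> < \<alpha>\<close> by auto
    have "(real n + 1) / 2 ^ cnt S n \<le> (2 powr K' * C) * (2 ^ n) powr (- \<beta>)" for n
    proof -
      have "real n + 1 = 2 powr (log 2 (1 + real n))" by simp
      also have "\<dots> \<le> 2 powr ((\<alpha> - \<beta>) * real n + K')" using K'[of "real n"] by (intro powr_mono) auto
      also have "\<dots> = 2 powr K' * ((2 ^ n) powr \<alpha> * (2 ^ n) powr (- \<beta>))"
        by (simp add: powr_add[symmetric] powr_powr algebra_simps flip: powr_realpow)
      also have "\<dots> \<le> 2 powr K' * ((C * 2 ^ cnt S n) * (2 ^ n) powr (- \<beta>))"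
        using below[of n] \<open>\<gamma> = 0\<close> by (intro mult_left_mono mult_right_mono) auto
      finally show ?thesis by (simp add: divide_simps mult_ac)
    qed
    then show ?thesis using C by (intro that[of "2 powr K' * C"]) auto
  qed
  have decay: "11 * sqrt ((real n + 1) / 2 ^ cnt S n) + 2 ^ cnt A n / 2 ^ cnt S n \<le> (11 * sqrt K + 1) * (2 ^ n) powr (- (\<beta> / 2))" for n
  proof -
    have "sqrt ((real n + 1) / 2 ^ cnt S n) \<le> sqrt (K * (2 ^ n) powr (- \<beta>))" using K by (intro real_sqrt_le_mono)
    also have "\<dots> = sqrt K * (2 ^ n) powr (- (\<beta> / 2))"
      by (simp add: real_sqrt_mult powr_half_sqrt[symmetric] powr_powr)
    finally have 1: "sqrt ((real n + 1) / 2 ^ cnt S n) \<le> sqrt K * (2 ^ n) powr (- (\<beta> / 2))" .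
    have "2 ^ cnt A n / 2 ^ cnt S n = 2 powr (real (cnt A n) - real (cnt S n))" by (simp add: powr_diff powr_realpow)
    also have "\<dots> \<le> 2 powr (- (\<beta> / 2 * real n))" using gap[of n] by (intro powr_mono) auto
    also have "\<dots> = (2 ^ n) powr (- (\<beta> / 2))" by (simp add: powr_powr mult.commute flip: powr_realpow)
    finally show ?thesis using 1 by (simp add: distrib_right)
  qed
  have "0 < \<beta> / 2" "\<beta> / 2 < 1" using ab by auto
  from tr.fourier_decay[OF this decay] obtain Cf where Cf: "\<And>\<xi>. \<xi> \<noteq> 0 \<Longrightarrow> norm (fourier_measure tr.\<mu> \<xi>) \<le> Cf * \<bar>\<xi>\<bar> powr (- (\<beta> / 2))"
    by blast
  \<comment> \<open>32 is 4 from \<open>2 ^ n \<le> 4 / r\<close> times 8 from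
    \<open>n + 1 \<le> 8 * Lg\<close>; below, 6 is the three cells of \<open>measure_le\<close>
    times 2 from \<open>1 / 2 ^ n \<le> 2 * r\<close>.\<close>
  define c where "c = 1 / (32 * C)"
  define C' where "C' = max (max c Cf) (6 * C)"
  have c: "0 < c" using C by (simp add: c_def)
  have pow\<gamma>: "x ^ \<gamma> \<le> max 1 x" for x :: real using \<gamma>(1) by (cases \<gamma>) auto
  have regular: "c * (interval_length I powr \<alpha> / (\<phi> (1 / interval_length I) * ln (1 / interval_length I) ^ \<gamma>)) \<le> measure tr.\<mu> I \<and>
           measure tr.\<mu> I \<le> C' * (interval_length I powr \<alpha> / ln (1 / interval_length I) ^ \<gamma>)"
    if I: "interval_centered_in I tr.E" "0 < interval_length I" "interval_length I < 1 / 2" for I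
  proof
    define r where "r = interval_length I"
    have r: "0 < r" "r < 1 / 2" using I by (auto simp: r_def)
    note facts = interval_facts[of I]
    have int: "is_interval I" "bounded I" "I \<noteq> {}" and mid: "midpoint (Inf I) (Sup I) \<in> tr.E"
      using I(1) by (auto simp: interval_centered_in_def)
    have Sup: "Sup I = Inf I + r" by (simp add: r_def interval_length_def)
    define Lg where "Lg = ln (1 / r)"
    have "ln 2 \<le> Lg" unfolding Lg_def using r by (subst ln_le_cancel_iff) (auto simp: field_simps)
    then have Lg: "1 / 2 \<le> Lg" "ln 2 \<le> Lg" using ln2_ge_two_thirds by linarith+
    show "measure tr.\<mu> I \<le> C' * (interval_length I powr \<alpha> / ln (1 / interval_length I) ^ \<gamma>)"
    proof -
      obtain n where n: "2 ^ n \<le> 1 / r" "1 / r < 2 ^ Suc n"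
        using power2_bracket[of "1 / r"] r by auto
      have rn: "r \<le> 1 / 2 ^ n" using n r by (simp add: field_simps)
      have "measure tr.\<mu> I \<le> 3 / 2 ^ cnt S n"
        using facts[OF int] Sup by (intro tr.measure_le[OF rn, of I "Inf I"]) auto
      also have "\<dots> \<le> 3 * (C / ((2 ^ n) powr \<alpha> * (real n + 1) ^ \<gamma>))"
        using below[of n] C by (simp add: field_simps)
      also have "\<dots> = 3 * C * ((1 / 2 ^ n) powr \<alpha> * (1 / (real n + 1) ^ \<gamma>))"
        by (simp add: powr_divide)
      also have "\<dots> \<le> 3 * C * ((2 * r powr \<alpha>) * (1 / Lg ^ \<gamma>))"
      proof (intro mult_left_mono mult_mono)
        have "1 / 2 ^ n \<le> 2 * r" using n r by (simp add: field_simps)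
        then have "(1 / 2 ^ n) powr \<alpha> \<le> (2 * r) powr \<alpha>" using ab by (intro powr_mono2) auto
        also have "\<dots> = 2 powr \<alpha> * r powr \<alpha>" using r by (simp add: powr_mult)
        also have "\<dots> \<le> 2 powr 1 * r powr \<alpha>" using ab by (intro mult_right_mono powr_mono) auto
        finally show "(1 / 2 ^ n) powr \<alpha> \<le> 2 * r powr \<alpha>" by simp
        have "Lg \<le> ln (2 ^ Suc n)" unfolding Lg_def using n r by (subst ln_le_cancel_iff) auto
        also have "\<dots> = (real n + 1) * ln 2" by (simp add: ln_realpow algebra_simps del: power_Suc)
        also have "\<dots> \<le> (real n + 1) * 1" using ln2_le_25_over_36 by (intro mult_left_mono) auto
        finally show "1 / (real n + 1) ^ \<gamma> \<le> 1 / Lg ^ \<gamma>"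
          using Lg by (intro divide_left_mono power_mono mult_pos_pos) auto
      qed (use C in auto)
      also have "\<dots> = 6 * C * (r powr \<alpha> / Lg ^ \<gamma>)" by simp
      also have "\<dots> \<le> C' * (r powr \<alpha> / Lg ^ \<gamma>)"
        unfolding C'_def using Lg by (intro mult_right_mono) auto
      finally show ?thesis by (simp add: r_def Lg_def)
    qed
    show "c * (interval_length I powr \<alpha> / (\<phi> (1 / interval_length I) * ln (1 / interval_length I) ^ \<gamma>)) \<le> measure tr.\<mu> I"
    proof -
      \<comment> \<open>Bracketing 2 / r and passing to \<open>Suc N\<close> makes cells shorter
        than r / 2, so a cell containing the midpoint lies inside the interval. As r < 1/2, this
        level is at least 3.\<close>
      obtain N where N: "2 ^ N \<le> 2 / r" "2 / r < 2 ^ Suc N"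
        using power2_bracket[of "2 / r"] r by auto
      define n where "n = Suc N"
      have n: "1 / 2 ^ n < r / 2" "2 ^ n \<le> 4 / r"
        using N r by (auto simp: n_def field_simps)
      have "(4::real) < 2 / r" using r by (simp add: field_simps)
      then have "(2::real) ^ 2 < 2 ^ n" using N unfolding n_def by simp
      then have n3: "3 \<le> n" by (simp only: power_strict_increasing_iff)
      have "{midpoint (Inf I) (Sup I) - r / 2<..<midpoint (Inf I) (Sup I) + r / 2} = {Inf I<..<Sup I}"
      proof -
        have "midpoint (Inf I) (Sup I) = Inf I + r / 2" by (simp add: Sup midpoint_def field_simps)
        then show ?thesis by (simp add: Sup add.assoc)
      qed
      then have ge: "1 / 2 ^ cnt S n \<le> measure tr.\<mu> I"
        using facts[OF int] by (intro tr.measure_ge[OF mid n(1)]) auto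
      have n8: "(2::real) ^ 3 \<le> 2 ^ n" using n3 by (intro power_increasing) auto
      have \<phi>: "\<phi> (2 ^ n / 4) \<le> \<phi> (1 / r)" "0 < \<phi> (2 ^ n / 4)"
        using n8 n(2) r by (auto intro!: mono_onD[OF \<phi>_mono] \<phi>_pos simp: field_simps)
      have pw: "(2 ^ n) powr \<alpha> \<le> 4 / r powr \<alpha>"
      proof -
        have "(2 ^ n) powr \<alpha> \<le> (4 / r) powr \<alpha>" using n r ab by (intro powr_mono2) auto
        also have "\<dots> = 4 powr \<alpha> / r powr \<alpha>" using r by (simp add: powr_divide)
        also have "\<dots> \<le> 4 powr 1 / r powr \<alpha>" using ab by (intro divide_right_mono powr_mono) auto
        finally show ?thesis by simp
      qed
      have lg: "(real n + 1) ^ \<gamma> \<le> 8 * Lg ^ \<gamma>"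
      proof -
        have "real n * ln 2 = ln (2 ^ n)" by (simp add: ln_realpow)
        also have "\<dots> \<le> ln (4 / r)" using n r by (subst ln_le_cancel_iff) auto
        also have "\<dots> = ln 4 + Lg" using r ln_mult[of 4 "1 / r"] by (simp add: Lg_def)
        also have "ln 4 = 2 * ln (2::real)" using ln_mult[of 2 "2::real"] by simp
        finally have "(real n + 1) * ln 2 \<le> 4 * Lg" using Lg by (simp add: distrib_right)
        moreover have "(real n + 1) * (1 / 2) \<le> (real n + 1) * ln 2"
          using ln2_ge_two_thirds by (intro mult_left_mono) auto
        ultimately have "(real n + 1) * (1 / 2) \<le> 4 * Lg" by (rule order_trans[rotated])
        then have "real n + 1 \<le> 8 * Lg" by simp
        then have "(real n + 1) ^ \<gamma> \<le> (8 * Lg) ^ \<gamma>" by (intro power_mono) auto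
        also have "\<dots> \<le> 8 * Lg ^ \<gamma>"
          using pow\<gamma>[of 8] Lg by (simp add: power_mult_distrib mult_right_mono)
        finally show ?thesis .
      qed
      have "2 ^ cnt S n \<le> C * ((2 ^ n) powr \<alpha> * (real n + 1) ^ \<gamma> * \<phi> (2 ^ n / 4))" by (rule above[OF n3])
      also have "\<dots> \<le> C * ((4 / r powr \<alpha>) * (8 * Lg ^ \<gamma>) * \<phi> (1 / r))"
        using C \<phi> pw lg r Lg by (intro mult_left_mono mult_mono) auto
      also have "\<dots> = 1 / (c * (r powr \<alpha> / (\<phi> (1 / r) * Lg ^ \<gamma>)))" by (simp add: c_def)
      finally have "2 ^ cnt S n \<le> 1 / (c * (r powr \<alpha> / (\<phi> (1 / r) * Lg ^ \<gamma>)))" .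
      moreover have "0 < c * (r powr \<alpha> / (\<phi> (1 / r) * Lg ^ \<gamma>))"
        using c r \<phi> Lg by (intro mult_pos_pos divide_pos_pos) auto
      ultimately have "c * (r powr \<alpha> / (\<phi> (1 / r) * Lg ^ \<gamma>)) \<le> 1 / 2 ^ cnt S n"
        by (simp only: pos_le_divide_eq zero_less_power zero_less_numeral) (simp only: mult.commute)
      then show ?thesis using ge by (simp add: r_def Lg_def)
    qed
  qed
  have divergent: "(SUP l\<in>{1..}. Lq_norm q lborel (fourier_measure (density tr.\<mu> (\<lambda>x. ennreal (indicator (tr.planted_cells (T l)) x))))
                         / Lq_norm 2 tr.\<mu> (indicator (tr.planted_cells (T l)) :: real \<Rightarrow> real)) = \<infinity>" (is "?sup = \<infinity>")
    if q: "2 \<le> q" "q < 2 + 4 * (1 - \<alpha>) / \<beta>" for q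
  proof -
    have "of_nat N \<le> ?sup" for N
    proof -
      have "3 * real l \<le> real (T l)" for l using T_ge[of l] by linarith
      then obtain l where l: "l \<ge> 3" and big: "real N \<le> (real (cnt A (T l)) - real (cnt S (T l))) / 2 - real l - 1
          + (real (T l) - real (cnt A (T l)) - 4 * real l - 5) / q" (is "_ \<le> ?x")
        using exponent_unbounded[OF ab(1) q, of "\<lambda>l. real (T l)" "\<lambda>l. real (cnt S (T l))" "\<lambda>l. real (cnt A (T l))" "real N"]
          S_T gap_T gap sublinear by blast
      have "real N \<le> 2 ^ N" using of_nat_less_two_power[of N, where ?'a = real] by simp
      also have "\<dots> = 2 powr real N" by (simp add: powr_realpow)
      also have "\<dots> \<le> 2 powr ?x" using big by (intro powr_mono) auto
      finally have "of_nat N \<le> ennreal (2 powr ?x)" by (simp add: ennreal_of_nat_eq_real_of_nat ennreal_leI)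
      also have "\<dots> \<le> Lq_norm q lborel (fourier_measure (density tr.\<mu> (\<lambda>x. ennreal (indicator (tr.planted_cells (T l)) x))))
                           / Lq_norm 2 tr.\<mu> (indicator (tr.planted_cells (T l)) :: real \<Rightarrow> real)"
        using q by (intro norm_ratio_ge[OF tree unb l]) auto
      also have "\<dots> \<le> ?sup" using l by (intro SUP_upper) auto
      finally show ?thesis .
    qed
    then have "(SUP N. of_nat N :: ennreal) \<le> ?sup" by (intro SUP_least)
    then show ?thesis by (simp add: ennreal_SUP_of_nat_eq_top top_unique)
  qed
  have positive: "Lq_norm 2 tr.\<mu> (indicator (tr.planted_cells n) :: real \<Rightarrow> real) > 0" for n
  proof -
    have "finite_measure tr.\<mu>" using tr.prob_space_mu by (rule prob_space.finite_measure)
    then show ?thesis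
      using tr.measure_planted_cells[OF unb, of n] by (subst Lq_norm_indicator) (auto simp: tr.sets_mu)
  qed
  show ?thesis
  proof (intro exI conjI allI impI)
    show "compact tr.E" by (rule tr.compact_E)
    show "prob_space tr.\<mu>" by (rule tr.prob_space_mu)
    show "sets tr.\<mu> = sets borel" by (rule tr.sets_mu)
    show "measure tr.\<mu> tr.E = 1" by (rule tr.measure_E)
    show "finite_union_of_intervals (tr.planted_cells (T l))" for l by (rule tr.finite_union_of_intervals_planted_cells)
    show "(\<lambda>l. indicator (tr.planted_cells (T l)) :: real \<Rightarrow> real) l = indicator (tr.planted_cells (T l))" for l by (rule refl)
    show "Lq_norm 2 tr.\<mu> (indicator (tr.planted_cells (T l)) :: real \<Rightarrow> real) > 0" for l by (rule positive)
    show "0 < c" by (rule c)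
    show "c \<le> C'" by (simp add: C'_def)
    fix \<xi> :: real assume "\<xi> \<noteq> 0"
    then have "norm (fourier_measure tr.\<mu> \<xi>) \<le> Cf * \<bar>\<xi>\<bar> powr (- (\<beta> / 2))" by (rule Cf)
    also have "\<dots> \<le> C' * \<bar>\<xi>\<bar> powr (- (\<beta> / 2))" unfolding C'_def by (intro mult_right_mono) auto
    finally show "norm (fourier_measure tr.\<mu> \<xi>) \<le> C' * \<bar>\<xi>\<bar> powr (- \<beta> / 2)" by simp
  next
    fix I assume "interval_centered_in I tr.E \<and> 0 < interval_length I \<and> interval_length I < 1 / 2"
    then show "c * (interval_length I powr \<alpha> / (\<phi> (1 / interval_length I) * ln (1 / interval_length I) ^ \<gamma>)) \<le> measure tr.\<mu> I"
      and "measure tr.\<mu> I \<le> C' * (interval_length I powr \<alpha> / ln (1 / interval_length I) ^ \<gamma>)"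
      using regular[of I] by auto
  next
    fix q assume "2 \<le> q \<and> q < 2 + 4 * (1 - \<alpha>) / \<beta>"
    then show "(SUP l\<in>{1..}. Lq_norm q lborel (fourier_measure (density tr.\<mu> (\<lambda>x. ennreal (indicator (tr.planted_cells (T l)) x))))
                         / Lq_norm 2 tr.\<mu> (indicator (tr.planted_cells (T l)) :: real \<Rightarrow> real)) = \<infinity>"
      using divergent by blast
  qed
qed

theorem theorem3:
  fixes \<alpha> \<beta> C\<^sub>0 :: real and \<phi> :: "real \<Rightarrow> real"
  assumes "0 < \<beta>" and "\<beta> \<le> \<alpha>" and "\<alpha> < 1"
    and "\<And>t. t \<ge> 2 \<Longrightarrow> \<phi> t > 0"
    and "mono_on {2..} \<phi>"
    and "filterlim \<phi> at_top at_top"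
    and "\<And>t. t \<ge> 2 \<Longrightarrow> \<phi> (2 * t) \<le> \<phi> t + C\<^sub>0"
  shows
    "(\<exists>(E :: real set) (\<mu> :: real measure) (f :: nat \<Rightarrow> real \<Rightarrow> real) (c :: real) (C :: real).
        compact E \<and> prob_space \<mu> \<and> sets \<mu> = sets borel \<and> measure \<mu> E = 1 \<and>
        (\<forall>l\<ge>1. (\<exists>S. finite_union_of_intervals S \<and> f l = indicator S) \<and> Lq_norm 2 \<mu> (f l) > 0) \<and>
        0 < c \<and> c \<le> C \<and>
        (\<forall>\<xi>. \<xi> \<noteq> 0 \<longrightarrow> norm (fourier_measure \<mu> \<xi>) \<le> C * \<bar>\<xi>\<bar> powr (- \<beta> / 2)) \<and>
        (\<forall>I. interval_centered_in I E \<and> 0 < interval_length I \<and> interval_length I < 1 / 2 \<longrightarrow>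
           c * (interval_length I powr \<alpha> / (\<phi> (1 / interval_length I) * ln (1 / interval_length I))) \<le> measure \<mu> I \<and>
           measure \<mu> I \<le> C * (interval_length I powr \<alpha> / ln (1 / interval_length I))) \<and>
        (\<forall>q. 2 \<le> q \<and> q < 2 + 4 * (1 - \<alpha>) / \<beta> \<longrightarrow>
           (SUP l\<in>{1..}. Lq_norm q lborel (fourier_measure (density \<mu> (\<lambda>x. ennreal (f l x))))
                         / Lq_norm 2 \<mu> (f l)) = \<infinity>))
     \<and>
     (\<beta> < \<alpha> \<longrightarrow>
      (\<exists>(E :: real set) (\<mu> :: real measure) (f :: nat \<Rightarrow> real \<Rightarrow> real) (c :: real) (C :: real).
        compact E \<and> prob_space \<mu> \<and> sets \<mu> = sets borel \<and> measure \<mu> E = 1 \<and>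
        (\<forall>l\<ge>1. (\<exists>S. finite_union_of_intervals S \<and> f l = indicator S) \<and> Lq_norm 2 \<mu> (f l) > 0) \<and>
        0 < c \<and> c \<le> C \<and>
        (\<forall>\<xi>. \<xi> \<noteq> 0 \<longrightarrow> norm (fourier_measure \<mu> \<xi>) \<le> C * \<bar>\<xi>\<bar> powr (- \<beta> / 2)) \<and>
        (\<forall>I. interval_centered_in I E \<and> 0 < interval_length I \<and> interval_length I < 1 / 2 \<longrightarrow>
           c * (interval_length I powr \<alpha> / \<phi> (1 / interval_length I)) \<le> measure \<mu> I \<and>
           measure \<mu> I \<le> C * interval_length I powr \<alpha>) \<and>
        (\<forall>q. 2 \<le> q \<and> q < 2 + 4 * (1 - \<alpha>) / \<beta> \<longrightarrow>
           (SUP l\<in>{1..}. Lq_norm q lborel (fourier_measure (density \<mu> (\<lambda>x. ennreal (f l x))))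
                         / Lq_norm 2 \<mu> (f l)) = \<infinity>)))"
  using near_extremal_measure[OF assms(1-3) _ _ assms(4-6), of 1]
    near_extremal_measure[OF assms(1-3) _ _ assms(4-6), of 0]
  by (intro conjI impI) (simp_all only: power_one_right power_0 mult_1_right div_by_1 le_refl zero_le_one simp_thms)

end
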